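(* Let $\mathfrak g$ be simple, with notation $\Delta_s,\theta_s,\Pi_s,l,e_1,\dots,e_l$ as in the context. For $\mu\in\Delta_s\cup\{0\}$ the polynomial $\mathfrak m_{\theta_s}^\mu(q)$ depends only on $\mathrm{ht}(\mu)$; more precisely: (i) $\mathfrak m_{\theta_s}^0(q)=q^{e_1}+\dots+q^{e_l}$; (ii) if $\mu\in\Delta_s\cap\Delta^+$, then $\mathfrak m_{\theta_s}^\mu(q)=q^{\mathrm{ht}(\theta_s-\mu)}$; (iii) if $\alpha\in\Pi_s$, then $\mathfrak m_{\theta_s}^{-\alpha}(q)=(q-1)\mathfrak m_{\theta_s}^0(q)+q^{\mathrm{ht}(\theta_s)}$; (iv) if $\gamma\in\Delta_s\cap\Delta^+$ and $\alpha\in\Pi_s$, then $\mathfrak m_{\theta_s}^{-\gamma}(q)=q^{\mathrm{ht}(\gamma)-1}\,\mathfrak m_{\theta_s}^{-\alpha}(q)$.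
   Context: Let $\mathfrak g$ be a semisimple Lie algebra over an algebraically closed field of characteristic zero, with Cartan subalgebra $\mathfrak t$, root system $\Delta$, positive roots $\Delta^+$, simple roots $\Pi=\{\alpha_1,\dots,\alpha_r\}$, $\rho=\frac12\sum_{\gamma\in\Delta^+}\gamma$, integral weight lattice $\mathfrak X$, dominant weights $\mathfrak X_+$, root lattice $Q$, and $Q_+$ the monoid generated by $\Pi$. The Weyl group is $W$, with length function $\ell$ and sign $\varepsilon(w)=(-1)^{\ell(w)}$. For $\gamma=\sum_i c_i\alpha_i\in Q$, $\mathrm{ht}(\gamma)=\sum_i c_i$. Define polynomials $\mathcal P_q(\mu)\in\mathbb Z[q]$ by $\prod_{\alpha\in\Delta^+}(1-qe^{\alpha})^{-1}=\sum_{\mu\in Q_+}\mathcal P_q(\mu)e^\mu$, and $\mathcal P_q(\mu)=0$ for $\mu\notin Q_+$. For $\lambda\in\mathfrak X_+$ and any $\mu\in\mathfrak X$, Lusztig's $q$-analogue of weight multiplicity is $\mathfrak m_\lambda^\mu(q)=\sum_{w\in W}\varepsilon(w)\mathcal P_q(w(\lambda+\rho)-(\mu+\rho))$. $\Delta_s$ is the set of short roots (all roots if $\mathfrak g$ is simply-laced), $\theta_s$ the unique dominant short root, $\Pi_s=\Pi\cap\Delta_s$, $l=\#\Pi_s$. For $i\ge1$, $n_{i,s}=\#\{\gamma\in\Delta^+\cap\Delta_s\mid\mathrm{ht}(\gamma)=i\}$, and $(e_1,\dots,e_l)$ is the partition dual (conjugate) to $(n_{1,s},n_{2,s},\dots)$.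 *)

theory Defs
  imports "HOL-Analysis.Analysis" "HOL-Computational_Algebra.Polynomial"
begin

(* Root systems in a real Euclidean space 'a.  The root system of the
   semisimple Lie algebra g (with respect to t) is realised in t*_R; we work
   with an abstract reduced crystallographic root system R spanning 'a. *)

definition coroot_pair :: "'a::euclidean_space \<Rightarrow> 'a \<Rightarrow> real" where
  "coroot_pair x a = 2 * (x \<bullet> a) / (a \<bullet> a)"

definition refl :: "'a::euclidean_space \<Rightarrow> 'a \<Rightarrow> 'a" where
  "refl a x = x - coroot_pair x a *\<^sub>R a"

definition root_system :: "'a::euclidean_space set \<Rightarrow> bool" where
  "root_system R \<longleftrightarrow> finite R \<and> 0 \<notin> R \<and> span R = UNIV
     \<and> (\<forall>a\<in>R. \<forall>b\<in>R. refl a b \<in> R)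
     \<and> (\<forall>a\<in>R. \<forall>b\<in>R. coroot_pair b a \<in> \<int>)
     \<and> (\<forall>a\<in>R. \<forall>c::real. c *\<^sub>R a \<in> R \<longrightarrow> c = 1 \<or> c = -1)"

definition irreducible_rs :: "'a::euclidean_space set \<Rightarrow> bool" where
  "irreducible_rs R \<longleftrightarrow> R \<noteq> {} \<and>
     \<not> (\<exists>A B. A \<noteq> {} \<and> B \<noteq> {} \<and> A \<union> B = R \<and> A \<inter> B = {}
          \<and> (\<forall>a\<in>A. \<forall>b\<in>B. a \<bullet> b = 0))"

definition pos_cone :: "'a::euclidean_space set \<Rightarrow> 'a set" where
  "pos_cone P = {x. \<exists>c::'a \<Rightarrow> nat. x = (\<Sum>a\<in>P. real (c a) *\<^sub>R a)}"

definition root_lattice :: "'a::euclidean_space set \<Rightarrow> 'a set" where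
  "root_lattice P = {x. \<exists>c::'a \<Rightarrow> int. x = (\<Sum>a\<in>P. real_of_int (c a) *\<^sub>R a)}"

definition is_base :: "'a::euclidean_space set \<Rightarrow> 'a set \<Rightarrow> bool" where
  "is_base R P \<longleftrightarrow> P \<subseteq> R \<and> independent P
     \<and> (\<forall>b\<in>R. b \<in> pos_cone P \<or> - b \<in> pos_cone P)"

definition pos_roots :: "'a::euclidean_space set \<Rightarrow> 'a set \<Rightarrow> 'a set" where
  "pos_roots R P = R \<inter> pos_cone P"

definition ht :: "'a::euclidean_space set \<Rightarrow> 'a \<Rightarrow> int" where
  "ht P x = (THE h. \<exists>c::'a \<Rightarrow> int. x = (\<Sum>a\<in>P. real_of_int (c a) *\<^sub>R a) \<and> h = sum c P)"

definition rho :: "'a::euclidean_space set \<Rightarrow> 'a set \<Rightarrow> 'a" where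
  "rho R P = (1/2) *\<^sub>R (\<Sum>a\<in>pos_roots R P. a)"

inductive_set weyl :: "'a::euclidean_space set \<Rightarrow> ('a \<Rightarrow> 'a) set" for R where
  weyl_id: "id \<in> weyl R"
| weyl_step: "w \<in> weyl R \<Longrightarrow> a \<in> R \<Longrightarrow> refl a \<circ> w \<in> weyl R"

definition wlen :: "'a::euclidean_space set \<Rightarrow> ('a \<Rightarrow> 'a) \<Rightarrow> nat" where
  "wlen P w = (LEAST n. \<exists>as. length as = n \<and> set as \<subseteq> P \<and> w = foldr (\<lambda>a f. refl a \<circ> f) as id)"

definition weights :: "'a::euclidean_space set \<Rightarrow> 'a set" where
  "weights R = {x. \<forall>a\<in>R. coroot_pair x a \<in> \<int>}"

definition dominant :: "'a::euclidean_space set \<Rightarrow> 'a set \<Rightarrow> 'a set" where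
  "dominant R P = {x \<in> weights R. \<forall>a\<in>P. coroot_pair x a \<ge> 0}"

(* q-analogue of Kostant's partition function: coefficient of e^mu in
   prod_{a in Delta+} (1 - q e^a)^{-1}, i.e. the sum of q^(sum f) over all
   f : Delta+ -> nat with sum_a f(a) a = mu *)
definition kostant_q :: "'a::euclidean_space set \<Rightarrow> 'a set \<Rightarrow> 'a \<Rightarrow> int poly" where
  "kostant_q R P mu =
     (\<Sum>f\<in>{f::'a \<Rightarrow> nat. (\<forall>x. x \<notin> pos_roots R P \<longrightarrow> f x = 0)
                     \<and> (\<Sum>a\<in>pos_roots R P. real (f a) *\<^sub>R a) = mu}.
        monom 1 (\<Sum>a\<in>pos_roots R P. f a))"

definition lusztig_m :: "'a::euclidean_space set \<Rightarrow> 'a set \<Rightarrow> 'a \<Rightarrow> 'a \<Rightarrow> int poly" where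
  "lusztig_m R P lam mu =
     (\<Sum>w\<in>weyl R. (-1) ^ wlen P w *
        kostant_q R P (w (lam + rho R P) - (mu + rho R P)))"

(* short roots (all roots if simply laced) *)
definition short_roots :: "'a::euclidean_space set \<Rightarrow> 'a set" where
  "short_roots R = {a \<in> R. \<forall>b\<in>R. a \<bullet> a \<le> b \<bullet> b}"

definition theta_s :: "'a::euclidean_space set \<Rightarrow> 'a set \<Rightarrow> 'a" where
  "theta_s R P = (THE t. t \<in> short_roots R \<and> t \<in> dominant R P)"

definition n_s :: "'a::euclidean_space set \<Rightarrow> 'a set \<Rightarrow> nat \<Rightarrow> nat" where
  "n_s R P i = card {g \<in> pos_roots R P \<inter> short_roots R. ht P g = int i}"

(* e_j, j = 1..l: the partition dual to (n_{1,s}, n_{2,s}, ...) *)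
definition e_s :: "'a::euclidean_space set \<Rightarrow> 'a set \<Rightarrow> nat \<Rightarrow> nat" where
  "e_s R P j = card {i. 1 \<le> i \<and> j \<le> n_s R P i}"

end

theory Submission
  imports Defs
begin

text \<open>
  For a simple root \<open>a\<close>, \<open>(1 - q e\<^sup>-\<^sup>a) \<Sum>\<^sub>\<mu> m\<^sub>\<lambda>\<^sup>\<mu>(q) e\<^sup>\<mu>\<close> is antisymmetric under the
  \<open>\<rho>\<close>-shifted action of the reflection \<open>s\<^sub>a\<close>. Comparing coefficients gives
  \<open>m(\<mu> - a) + m(s\<^sub>a \<mu>) = q (m(\<mu>) + m(s\<^sub>a \<mu> + a))\<close>; in particular \<open>m(\<mu> - a) = q m(\<mu>)\<close> if
  \<open>\<mu>\<close> pairs to 1 with the coroot of \<open>a\<close>, and \<open>m(-a) = (q - 1) m(0) + q m(a)\<close>. A short root pairs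
  to -1, 0 or 1 with every coroot not proportional to its own, so walking along the short roots from
  \<open>m(\<theta>\<^sub>s) = 1\<close> yields everything except the value at weight 0.

  For that value, the Brauer-Klimyk formula expresses \<open>m\<close> for highest weight \<open>\<theta>\<^sub>s\<close> through the
  polynomials for highest weight 0, which the same recurrences compute:
  \<open>m(0) = l + \<Sum> (q\<^sup>h - q\<^sup>h\<^sup>-\<^sup>1)\<close>, where \<open>h\<close> runs over the heights of the positive short roots.
  This is \<open>\<Sum> q\<^sup>e\<close> over the dual partition because the numbers of short roots of given
  height decrease, by an \<open>sl\<^sub>2\<close> argument.
\<close>

section \<open>Reflections\<close>

lemma linear_refl: "linear (refl a)"
  by (rule linearI) (auto simp: refl_def coroot_pair_def inner_add_left algebra_simps add_divide_distrib)

lemmas refl_add = linear_add[OF linear_refl]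
  and refl_diff = linear_diff[OF linear_refl]
  and refl_scaleR = linear_cmul[OF linear_refl]
  and refl_minus_right = linear_neg[OF linear_refl]
  and refl_sum = linear_sum[OF linear_refl]

lemma coroot_pair_add: "coroot_pair (x + y) a = coroot_pair x a + coroot_pair y a"
  by (simp add: coroot_pair_def inner_add_left algebra_simps add_divide_distrib)

lemma coroot_pair_diff: "coroot_pair (x - y) a = coroot_pair x a - coroot_pair y a"
  by (simp add: coroot_pair_def inner_diff_left algebra_simps diff_divide_distrib)

lemma coroot_pair_minus: "coroot_pair (- x) a = - coroot_pair x a"
  by (simp add: coroot_pair_def)

lemma coroot_pair_self: "a \<noteq> 0 \<Longrightarrow> coroot_pair a a = 2"
  by (simp add: coroot_pair_def)

lemma refl_self: "a \<noteq> 0 \<Longrightarrow> refl a a = - a"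
  by (simp add: refl_def coroot_pair_self scaleR_2)

lemma refl_uminus: "refl (- a) = refl a"
  by (rule ext) (simp add: refl_def coroot_pair_def)

text \<open>For \<open>a = 0\<close> the division by zero in \<open>coroot_pair\<close> gives 0, so
  \<open>refl 0\<close> is the identity and no side condition arises.\<close>

lemma refl_refl: "refl a (refl a x) = x"
  by (cases "a = 0")
    (simp_all add: refl_def coroot_pair_diff coroot_pair_def inner_diff_left algebra_simps)

lemma refl_comp_refl: "refl a \<circ> refl a = id"
  by (rule ext) (simp add: refl_refl)

lemma inner_refl: "refl a x \<bullet> refl a y = x \<bullet> y"
  by (cases "a = 0")
    (simp_all add: refl_def coroot_pair_def inner_diff_left inner_diff_right inner_commute)

text \<open>This is the composite appearing in \<open>wlen\<close>; the head of the list acts last,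
  and the reversed list gives the inverse.\<close>

definition refl_word :: "'a::euclidean_space list \<Rightarrow> 'a \<Rightarrow> 'a" where
  "refl_word as = foldr (\<lambda>a f. refl a \<circ> f) as id"

lemma refl_word_Nil [simp]: "refl_word [] = id"
  by (simp add: refl_word_def)

lemma refl_word_Cons [simp]: "refl_word (a # as) = refl a \<circ> refl_word as"
  by (simp add: refl_word_def)

lemma refl_word_append: "refl_word (as @ bs) = refl_word as \<circ> refl_word bs"
  by (induction as) (auto simp: comp_assoc)

lemma refl_word_rev: "refl_word (rev as) \<circ> refl_word as = id"
proof (induction as)
  case (Cons a as)
  have "refl_word (rev (a # as)) \<circ> refl_word (a # as)
      = refl_word (rev as) \<circ> ((refl a \<circ> refl a) \<circ> refl_word as)"
    by (simp add: refl_word_append comp_assoc)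
  also have "\<dots> = id" using Cons by (simp only: refl_comp_refl id_comp)
  finally show ?case .
qed simp

lemma refl_word_rev': "refl_word as \<circ> refl_word (rev as) = id"
  using refl_word_rev[of "rev as"] by simp

lemma refl_word_rev_apply [simp]: "refl_word (rev as) (refl_word as x) = x"
  using refl_word_rev[of as] by (metis comp_apply id_apply)

lemma refl_word_rev_apply' [simp]: "refl_word as (refl_word (rev as) x) = x"
  using refl_word_rev'[of as] by (metis comp_apply id_apply)

lemma linear_refl_word: "linear (refl_word as)"
proof (induction as)
  case Nil
  show ?case by (simp add: linear_id[unfolded id_def] id_def)
next
  case (Cons a as)
  then show ?case unfolding refl_word_Cons by (intro linear_compose linear_refl)
qed

lemma inner_refl_word: "refl_word as x \<bullet> refl_word as y = x \<bullet> y"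
  by (induction as) (simp_all add: inner_refl)

text \<open>Words act by isometries, and an isometry conjugates the reflection in a vector to the
  reflection in its image.\<close>

lemma refl_conj_word: "refl (refl_word as a) = refl_word as \<circ> refl a \<circ> refl_word (rev as)"
proof (rule ext)
  fix x
  have 1: "x \<bullet> refl_word as a = refl_word (rev as) x \<bullet> a"
    by (metis inner_refl_word refl_word_rev_apply')
  have "refl (refl_word as a) x = x - (2 * (refl_word (rev as) x \<bullet> a) / (a \<bullet> a)) *\<^sub>R refl_word as a"
    by (simp add: refl_def coroot_pair_def 1 inner_refl_word)
  also have "\<dots> = refl_word as (refl a (refl_word (rev as) x))"
    by (simp add: refl_def coroot_pair_def linear_diff[OF linear_refl_word]
        linear_cmul[OF linear_refl_word])
  finally show "refl (refl_word as a) x = (refl_word as \<circ> refl a \<circ> refl_word (rev as)) x"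
    by simp
qed

section \<open>Root systems with a base\<close>

locale based_root_system =
  fixes R P :: "'a::euclidean_space set"
  assumes root_system: "root_system R" and base: "is_base R P"
begin

abbreviation \<Delta>p :: "'a set" where "\<Delta>p \<equiv> pos_roots R P"

abbreviation cf :: "'a \<Rightarrow> 'a \<Rightarrow> real" where "cf \<equiv> representation P"

lemma finite_R: "finite R" and zero_notin_R: "0 \<notin> R" and span_R: "span R = UNIV"
  and refl_in_R: "a \<in> R \<Longrightarrow> b \<in> R \<Longrightarrow> refl a b \<in> R"
  and coroot_pair_Ints: "a \<in> R \<Longrightarrow> b \<in> R \<Longrightarrow> coroot_pair b a \<in> \<int>"
  and reduced: "a \<in> R \<Longrightarrow> c *\<^sub>R a \<in> R \<Longrightarrow> c = 1 \<or> c = -1"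
  using root_system by (auto simp: root_system_def)

lemma P_sub: "P \<subseteq> R" and indep_P: "independent P"
  and root_cases: "b \<in> R \<Longrightarrow> b \<in> pos_cone P \<or> - b \<in> pos_cone P"
  using base by (auto simp: is_base_def)

lemma finite_P: "finite P"
  using P_sub finite_R finite_subset by blast

lemma P_in_R: "a \<in> P \<Longrightarrow> a \<in> R"
  using P_sub by blast

lemma nonzero_root: "a \<in> R \<Longrightarrow> a \<noteq> 0"
  using zero_notin_R by blast

lemma uminus_root: "a \<in> R \<Longrightarrow> - a \<in> R"
  using refl_in_R[of a a] refl_self[of a] nonzero_root by simp

lemma pos_cone_span: "x \<in> pos_cone P \<Longrightarrow> x \<in> span P"
  unfolding pos_cone_def by (auto intro: span_sum span_scale span_base)

lemma span_P: "span P = UNIV"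
proof -
  have "R \<subseteq> span P"
    using root_cases pos_cone_span span_neg by fastforce
  then have "span R \<subseteq> span P"
    by (simp add: span_minimal)
  then show ?thesis using span_R by blast
qed

lemma in_span_P [simp]: "x \<in> span P"
  using span_P by simp

section \<open>Coordinates with respect to the base\<close>

lemma cf_add: "cf (x + y) a = cf x a + cf y a"
  and cf_diff: "cf (x - y) a = cf x a - cf y a"
  and cf_minus: "cf (- x) a = - cf x a"
  and cf_scaleR: "cf (r *\<^sub>R x) a = r * cf x a"
  using indep_P by (simp_all add: representation_add representation_diff representation_neg
      representation_scale)

lemma cf_zero: "cf 0 a = 0"
  by (simp add: representation_zero)

lemma cf_sum: "cf (\<Sum>i\<in>A. f i) a = (\<Sum>i\<in>A. cf (f i) a)"
  by (induction A rule: infinite_finite_induct) (auto simp: cf_zero cf_add)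

lemma cf_base: "a \<in> P \<Longrightarrow> cf a b = (if b = a then 1 else 0)"
  using representation_basis[OF indep_P] by simp

lemma cf_expand: "x = (\<Sum>a\<in>P. cf x a *\<^sub>R a)"
  using sum_representation_eq[OF indep_P, of x P] finite_P by simp

lemma cf_combination: "b \<in> P \<Longrightarrow> cf (\<Sum>a\<in>P. c a *\<^sub>R a) b = c b"
  by (simp add: cf_sum cf_scaleR cf_base finite_P if_distrib[of "(*) _"] cong: if_cong)

lemma cf_eqI: "(\<And>a. a \<in> P \<Longrightarrow> cf x a = cf y a) \<Longrightarrow> x = y"
  by (metis (mono_tags, lifting) cf_expand sum.cong)

lemma cf_refl: "a \<in> P \<Longrightarrow> b \<noteq> a \<Longrightarrow> cf (refl a x) b = cf x b"
  by (simp add: refl_def cf_diff cf_scaleR cf_base)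

lemma pos_cone_iff: "x \<in> pos_cone P \<longleftrightarrow> (\<forall>a\<in>P. cf x a \<in> \<nat>)"
proof
  assume "x \<in> pos_cone P"
  then show "\<forall>a\<in>P. cf x a \<in> \<nat>"
    by (auto simp: pos_cone_def cf_combination)
next
  assume "\<forall>a\<in>P. cf x a \<in> \<nat>"
  then have "\<forall>a\<in>P. \<exists>n. cf x a = real n"
    by (auto elim!: Nats_cases)
  then obtain c where "\<forall>a\<in>P. cf x a = real (c a)"
    by metis
  then have "x = (\<Sum>a\<in>P. real (c a) *\<^sub>R a)"
    by (subst cf_expand) simp
  then show "x \<in> pos_cone P"
    by (auto simp: pos_cone_def)
qed

lemma pos_root_R: "b \<in> \<Delta>p \<Longrightarrow> b \<in> R"
  by (simp add: pos_roots_def)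

lemma cf_Ints: "b \<in> R \<Longrightarrow> a \<in> P \<Longrightarrow> cf b a \<in> \<int>"
  using root_cases[of b] by (auto simp: pos_cone_iff cf_minus dest!: bspec Nats_subset_Ints[THEN subsetD])

lemma cf_nonneg: "b \<in> \<Delta>p \<Longrightarrow> a \<in> P \<Longrightarrow> cf b a \<ge> 0"
  by (auto simp: pos_roots_def pos_cone_iff elim!: Nats_cases dest!: bspec)

lemma pos_or_neg: "b \<in> R \<Longrightarrow> b \<in> \<Delta>p \<or> - b \<in> \<Delta>p"
  using root_cases uminus_root by (auto simp: pos_roots_def)

lemma pos_not_neg: "b \<in> \<Delta>p \<Longrightarrow> - b \<notin> \<Delta>p"
proof
  assume "b \<in> \<Delta>p" "- b \<in> \<Delta>p"
  then have "cf b a = cf 0 a" if "a \<in> P" for a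
    using cf_nonneg[of b a] cf_nonneg[of "- b" a] that by (simp add: cf_minus cf_zero)
  then have "b = 0" by (rule cf_eqI)
  then show False using \<open>b \<in> \<Delta>p\<close> pos_root_R zero_notin_R by blast
qed

lemma pos_if_cf_pos: "b \<in> R \<Longrightarrow> a \<in> P \<Longrightarrow> cf b a > 0 \<Longrightarrow> b \<in> \<Delta>p"
  using pos_or_neg[of b] cf_nonneg[of "- b" a] by (auto simp: cf_minus)

lemma P_pos: "a \<in> P \<Longrightarrow> a \<in> \<Delta>p"
  using pos_if_cf_pos[of a a] P_in_R by (simp add: cf_base)

lemma finite_pos: "finite \<Delta>p"
  using finite_R by (simp add: pos_roots_def)

text \<open>The reflection changes only the coordinate at \<open>a\<close>. As \<open>R\<close> is
  reduced, \<open>b\<close> has another positive coordinate; it survives, and one positive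
  coordinate already makes a root positive.\<close>

lemma refl_pos:
  assumes "a \<in> P" "b \<in> \<Delta>p" "b \<noteq> a"
  shows "refl a b \<in> \<Delta>p"
proof -
  have "\<exists>c\<in>P. c \<noteq> a \<and> cf b c > 0"
  proof (rule ccontr)
    assume "\<not> ?thesis"
    then have "cf b c = 0" if "c \<in> P" "c \<noteq> a" for c
      using that cf_nonneg[OF assms(2)] by force
    then have "cf b c = cf (cf b a *\<^sub>R a) c" if "c \<in> P" for c
      using that assms(1) by (auto simp: cf_scaleR cf_base)
    then have eq: "b = cf b a *\<^sub>R a" by (rule cf_eqI)
    then have "cf b a = 1 \<or> cf b a = -1"
      using reduced[of a "cf b a"] assms P_in_R pos_root_R by simp
    then have "cf b a = 1" using cf_nonneg[OF assms(2,1)] by linarith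
    then show False using eq assms(3) by simp
  qed
  then obtain c where "c \<in> P" "c \<noteq> a" "cf b c > 0" by blast
  then show ?thesis
    using pos_if_cf_pos[of "refl a b" c] cf_refl[OF assms(1), of c b] assms refl_in_R P_in_R pos_root_R
    by simp
qed

lemma refl_bij_pos: "a \<in> P \<Longrightarrow> bij_betw (refl a) (\<Delta>p - {a}) (\<Delta>p - {a})"
proof (rule bij_betw_byWitness[of _ "refl a"])
  assume a: "a \<in> P"
  have "refl a b \<noteq> a" if "b \<in> \<Delta>p" for b
  proof
    assume "refl a b = a"
    then have "b = - a" using refl_refl[of a b] refl_self nonzero_root P_in_R a by metis
    then show False using that a P_pos pos_not_neg by blast
  qed
  then show "refl a ` (\<Delta>p - {a}) \<subseteq> \<Delta>p - {a}" using refl_pos a by auto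
  then show "refl a ` (\<Delta>p - {a}) \<subseteq> \<Delta>p - {a}" .
qed (auto simp: refl_refl)

text \<open>The weight \<open>f\<close> allows a common treatment of the half sum of positive roots
  (\<open>f = 1/2\<close>) and that of positive coroots
  (\<open>f b = 1 / (b \<bullet> b)\<close>).\<close>

lemma sum_pos_refl:
  assumes "a \<in> P" and inv: "\<And>b. f (refl a b) = f b"
  shows "refl a (\<Sum>b\<in>\<Delta>p. f b *\<^sub>R b) = (\<Sum>b\<in>\<Delta>p. f b *\<^sub>R b) - (2 * f a) *\<^sub>R a"
proof -
  have split: "(\<Sum>b\<in>\<Delta>p. f b *\<^sub>R b) = f a *\<^sub>R a + (\<Sum>b\<in>\<Delta>p - {a}. f b *\<^sub>R b)"
    using sum.remove[OF finite_pos P_pos[OF assms(1)]] .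
  have "refl a (\<Sum>b\<in>\<Delta>p - {a}. f b *\<^sub>R b) = (\<Sum>b\<in>\<Delta>p - {a}. f (refl a b) *\<^sub>R refl a b)"
    by (simp add: refl_sum refl_scaleR inv)
  also have "\<dots> = (\<Sum>b\<in>\<Delta>p - {a}. f b *\<^sub>R b)"
    by (rule sum.reindex_bij_betw[OF refl_bij_pos[OF assms(1)]])
  finally show ?thesis
    using refl_self[OF nonzero_root[OF P_in_R[OF assms(1)]]]
    by (simp add: split refl_add refl_scaleR scaleR_2 flip: scaleR_scaleR)
qed

section \<open>Half sums of positive roots and coroots, and the height\<close>

lemma rho_eq: "rho R P = (\<Sum>b\<in>\<Delta>p. (1/2) *\<^sub>R b)"
  by (simp add: rho_def scaleR_sum_right)

lemma refl_rho: "a \<in> P \<Longrightarrow> refl a (rho R P) = rho R P - a"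
  using sum_pos_refl[of a "\<lambda>_. 1/2"] by (simp add: rho_eq)

lemma coroot_pair_rho: "a \<in> P \<Longrightarrow> coroot_pair (rho R P) a = 1"
proof -
  assume a: "a \<in> P"
  then have "coroot_pair (rho R P) a *\<^sub>R a = 1 *\<^sub>R a"
    using refl_rho[OF a] by (simp add: refl_def)
  then show ?thesis using nonzero_root[OF P_in_R[OF a]] by (metis scaleR_cancel_right)
qed

text \<open>Half the sum of the positive coroots \<open>2 b / (b \<bullet> b)\<close>. It pairs to 1
  with every simple root.\<close>

definition rho_dual :: 'a where
  "rho_dual = (\<Sum>b\<in>\<Delta>p. (1 / (b \<bullet> b)) *\<^sub>R b)"

lemma inner_rho_dual: "a \<in> P \<Longrightarrow> a \<bullet> rho_dual = 1"
proof -
  assume a: "a \<in> P"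
  then have nz: "a \<bullet> a \<noteq> 0" using nonzero_root[OF P_in_R] by simp
  have "refl a rho_dual = rho_dual - (2 * (1 / (a \<bullet> a))) *\<^sub>R a"
    unfolding rho_dual_def by (rule sum_pos_refl[OF a]) (simp add: inner_refl)
  then have "coroot_pair rho_dual a *\<^sub>R a = (2 * (1 / (a \<bullet> a))) *\<^sub>R a"
    by (simp add: refl_def)
  then have "coroot_pair rho_dual a = 2 / (a \<bullet> a)"
    using nz by (metis inner_zero_left scaleR_cancel_right mult.right_neutral times_divide_eq_right)
  then show ?thesis using nz by (simp add: coroot_pair_def inner_commute field_simps)
qed

text \<open>The height as a linear functional on the whole space; it agrees with \<open>ht\<close>
  on integral combinations of simple roots and avoids its definite description.\<close>

definition hgt :: "'a \<Rightarrow> real" where "hgt x = x \<bullet> rho_dual"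

lemma hgt_add: "hgt (x + y) = hgt x + hgt y"
  and hgt_diff: "hgt (x - y) = hgt x - hgt y"
  and hgt_minus: "hgt (- x) = - hgt x"
  and hgt_scaleR: "hgt (r *\<^sub>R x) = r * hgt x"
  and hgt_zero: "hgt 0 = 0"
  and hgt_sum: "hgt (sum f A) = (\<Sum>i\<in>A. hgt (f i))"
  by (simp_all add: hgt_def inner_add_left inner_diff_left inner_sum_left)

lemma hgt_base: "a \<in> P \<Longrightarrow> hgt a = 1"
  by (simp add: hgt_def inner_rho_dual)

lemma hgt_eq_sum: "hgt x = (\<Sum>a\<in>P. cf x a)"
  by (subst cf_expand) (simp add: hgt_sum hgt_scaleR hgt_base)

lemma ht_eq:
  assumes "\<And>a. a \<in> P \<Longrightarrow> cf x a \<in> \<int>"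
  shows "real_of_int (ht P x) = hgt x"
proof -
  have "\<forall>a\<in>P. \<exists>n. cf x a = real_of_int n"
    using assms by (auto elim!: Ints_cases)
  then obtain c where c: "\<forall>a\<in>P. cf x a = real_of_int (c a)"
    by metis
  then have x: "x = (\<Sum>a\<in>P. real_of_int (c a) *\<^sub>R a)"
    by (subst cf_expand) simp
  have "ht P x = sum c P"
    unfolding ht_def
  proof (rule the_equality)
    show "\<exists>d. x = (\<Sum>a\<in>P. real_of_int (d a) *\<^sub>R a) \<and> sum c P = sum d P"
      using x by blast
    fix h assume "\<exists>d. x = (\<Sum>a\<in>P. real_of_int (d a) *\<^sub>R a) \<and> h = sum d P"
    then obtain d where d: "x = (\<Sum>a\<in>P. real_of_int (d a) *\<^sub>R a)" "h = sum d P" by blast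
    then have "d a = c a" if "a \<in> P" for a
      using c cf_combination[OF that, of "\<lambda>a. real_of_int (d a)"] that by simp
    then show "h = sum c P" using d by simp
  qed
  then show ?thesis using c by (simp add: hgt_eq_sum)
qed

lemma ht_root: "b \<in> R \<Longrightarrow> real_of_int (ht P b) = hgt b"
  using ht_eq cf_Ints by blast

lemma hgt_Ints: "b \<in> R \<Longrightarrow> hgt b \<in> \<int>"
  by (metis Ints_of_int ht_root)

lemma hgt_pos: "b \<in> \<Delta>p \<Longrightarrow> hgt b \<ge> 1"
proof -
  assume b: "b \<in> \<Delta>p"
  have "\<exists>a\<in>P. cf b a \<noteq> 0"
    using cf_eqI[of b 0] zero_notin_R pos_root_R[OF b] by (metis cf_zero)
  then have "hgt b > 0"
    unfolding hgt_eq_sum using cf_nonneg[OF b] finite_P by (metis order_le_less sum_pos2)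
  then show ?thesis using hgt_Ints[OF pos_root_R[OF b]] by (auto elim!: Ints_cases)
qed

lemma hgt_nonneg: "b \<in> \<Delta>p \<Longrightarrow> hgt b \<ge> 0"
  using hgt_pos[of b] by simp

lemma hgt_refl: "a \<in> P \<Longrightarrow> hgt (refl a x) = hgt x - coroot_pair x a"
  by (simp add: refl_def hgt_diff hgt_scaleR hgt_base)

lemma hgt_one_simple:
  assumes b: "b \<in> \<Delta>p" and "hgt b = 1"
  shows "b \<in> P"
proof -
  have "\<exists>a\<in>P. cf b a \<noteq> 0"
    using cf_eqI[of b 0] zero_notin_R pos_root_R[OF b] by (metis cf_zero)
  then obtain a where a: "a \<in> P" "cf b a \<noteq> 0" by blast
  then have "cf b a \<ge> 1"
    using cf_nonneg[OF b a(1)] cf_Ints[OF pos_root_R[OF b] a(1)] by (auto elim!: Ints_cases)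
  moreover have eq: "(\<Sum>c\<in>P. cf b c) = cf b a + (\<Sum>c\<in>P - {a}. cf b c)"
    by (rule sum.remove[OF finite_P a(1)])
  moreover have nn: "(\<Sum>c\<in>P - {a}. cf b c) \<ge> 0"
    by (rule sum_nonneg) (use cf_nonneg[OF b] in auto)
  ultimately have "cf b a = 1" "(\<Sum>c\<in>P - {a}. cf b c) = 0"
    using assms(2) unfolding hgt_eq_sum by linarith+
  then have "\<forall>c\<in>P - {a}. cf b c = 0"
    using sum_nonneg_eq_0_iff[of "P - {a}" "cf b"] cf_nonneg[OF b] finite_P by auto
  then have "b = a"
    using \<open>cf b a = 1\<close> a(1) by (intro cf_eqI) (auto simp: cf_base)
  then show ?thesis using a by simp
qed

text \<open>Otherwise expanding the second factor of \<open>b \<bullet> b\<close> in simple roots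
  would give a sum of nonpositive terms.\<close>

lemma exists_simple_inner_pos:
  assumes "b \<in> \<Delta>p"
  shows "\<exists>a\<in>P. b \<bullet> a > 0"
proof (rule ccontr)
  assume "\<not> ?thesis"
  then have "cf b a * (b \<bullet> a) \<le> 0" if "a \<in> P" for a
    using that cf_nonneg[OF assms that] by (auto simp: mult_le_0_iff not_less)
  then have "(\<Sum>a\<in>P. cf b a * (b \<bullet> a)) \<le> 0" by (rule sum_nonpos)
  moreover have "b \<bullet> b = (\<Sum>a\<in>P. cf b a * (b \<bullet> a))"
    by (subst (2) cf_expand) (simp add: inner_sum_right)
  ultimately show False
    using nonzero_root[OF pos_root_R[OF assms]] by (metis inner_gt_zero_iff not_less)
qed

section \<open>Generation of the Weyl group by simple reflections\<close>

lemma coroot_pair_pos_iff: "a \<in> R \<Longrightarrow> coroot_pair x a > 0 \<longleftrightarrow> x \<bullet> a > 0"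
  and coroot_pair_neg_iff: "a \<in> R \<Longrightarrow> coroot_pair x a < 0 \<longleftrightarrow> x \<bullet> a < 0"
  and coroot_pair_nonneg_iff: "a \<in> R \<Longrightarrow> coroot_pair x a \<ge> 0 \<longleftrightarrow> x \<bullet> a \<ge> 0"
  using nonzero_root[of a] not_less[THEN iffD2, OF inner_ge_zero[of a]]
  by (auto simp: coroot_pair_def zero_less_divide_iff divide_less_0_iff
      simp flip: not_less)

text \<open>Induction on the height: a simple reflection with positive pairing lowers the height of
  a nonsimple positive root and keeps it positive.\<close>

lemma pos_root_conj_simple:
  "b \<in> \<Delta>p \<Longrightarrow> \<exists>as a. set as \<subseteq> P \<and> a \<in> P \<and> b = refl_word as a"
proof (induction "nat \<lfloor>hgt b\<rfloor>" arbitrary: b rule: less_induct)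
  case less
  show ?case
  proof (cases "b \<in> P")
    case True
    then show ?thesis by (intro exI[of _ "[]"] exI[of _ b]) auto
  next
    case False
    obtain a where a: "a \<in> P" "b \<bullet> a > 0"
      using exists_simple_inner_pos[OF less.prems] by blast
    have pos: "refl a b \<in> \<Delta>p" using refl_pos a less.prems False by metis
    have "coroot_pair b a > 0" using a coroot_pair_pos_iff P_in_R by blast
    moreover have "coroot_pair b a \<in> \<int>"
      using a coroot_pair_Ints less.prems P_in_R pos_root_R by blast
    ultimately have "coroot_pair b a \<ge> 1" by (auto elim!: Ints_cases)
    then have "nat \<lfloor>hgt (refl a b)\<rfloor> < nat \<lfloor>hgt b\<rfloor>"
      using hgt_pos[OF less.prems] hgt_refl[OF a(1), of b] hgt_pos[OF pos] by linarith
    then obtain as c where "set as \<subseteq> P" "c \<in> P" "refl a b = refl_word as c"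
      using less.hyps pos by blast
    then show ?thesis
      using a refl_refl[of a b] by (intro exI[of _ "a # as"] exI[of _ c]) auto
  qed
qed

lemma root_conj_simple: "b \<in> R \<Longrightarrow> \<exists>as a. set as \<subseteq> P \<and> a \<in> P \<and> refl b = refl (refl_word as a)"
  using pos_or_neg[of b] pos_root_conj_simple[of b] pos_root_conj_simple[of "- b"]
  by (metis refl_uminus)

text \<open>\<open>weyl\<close> is generated by all reflections, \<open>wlen\<close> counts simple
  ones. The reflection in any root is a conjugate of a simple reflection, hence itself a word in
  simple reflections.\<close>

lemma weyl_eq: "weyl R = refl_word ` {as. set as \<subseteq> P}"
proof (intro equalityI subsetI)
  fix w assume "w \<in> weyl R"
  then show "w \<in> refl_word ` {as. set as \<subseteq> P}"
  proof induction
    case weyl_id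
    then show ?case by (intro image_eqI[of _ _ "[]"]) auto
  next
    case (weyl_step w b)
    then obtain bs where bs: "set bs \<subseteq> P" "w = refl_word bs" by blast
    obtain as a where "set as \<subseteq> P" "a \<in> P" "refl b = refl (refl_word as a)"
      using root_conj_simple weyl_step by blast
    then have "refl b \<circ> w = refl_word (as @ [a] @ rev as @ bs)"
      "set (as @ [a] @ rev as @ bs) \<subseteq> P"
      using bs by (auto simp: refl_word_append refl_conj_word comp_assoc)
    then show ?case by blast
  qed
next
  fix w assume "w \<in> refl_word ` {as. set as \<subseteq> P}"
  then obtain as where "set as \<subseteq> P" "w = refl_word as" by blast
  then show "w \<in> weyl R"
  proof (induction as arbitrary: w)
    case Nil
    then show ?case using weyl_id[of R] by (simp only: refl_word_Nil)
  next
    case (Cons a as)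
    then have "refl_word as \<in> weyl R" "a \<in> R" using P_in_R by auto
    then show ?case using weyl_step[of "refl_word as" R a] Cons.prems by (simp only: refl_word_Cons)
  qed
qed

lemma weyl_cases:
  assumes "w \<in> weyl R"
  obtains as where "set as \<subseteq> P" "w = refl_word as"
  using assms weyl_eq by blast

lemma refl_word_weyl: "set as \<subseteq> P \<Longrightarrow> refl_word as \<in> weyl R"
  using weyl_eq by blast

lemma refl_word_root: "set as \<subseteq> P \<Longrightarrow> b \<in> R \<Longrightarrow> refl_word as b \<in> R"
  by (induction as) (auto intro: refl_in_R P_in_R)

text \<open>Elements are linear and map the finite spanning set \<open>R\<close> into itself, so
  restriction to \<open>R\<close> embeds the group into a finite set of functions.\<close>

lemma finite_weyl: "finite (weyl R)"
proof (rule finite_imageD)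
  have "(\<lambda>w. restrict w R) ` weyl R \<subseteq> R \<rightarrow>\<^sub>E R"
    using refl_word_root by (auto simp: weyl_eq)
  then show "finite ((\<lambda>w. restrict w R) ` weyl R)"
    using finite_subset finite_R finite_PiE[of R "\<lambda>_. R"] by blast
  show "inj_on (\<lambda>w. restrict w R) (weyl R)"
  proof (rule inj_onI)
    fix v w assume vw: "v \<in> weyl R" "w \<in> weyl R" "restrict v R = restrict w R"
    have "linear v" "linear w" using vw linear_refl_word by (auto simp: weyl_eq)
    moreover have "v x = w x" if "x \<in> R" for x using vw(3) that by (metis restrict_apply')
    ultimately show "v = w"
      using linear_eq_on_span[of v w R] span_R by auto
  qed
qed

end

section \<open>Signs and trivial stabilizers in the Weyl group\<close>

context based_root_system
begin

definition inversions :: "('a \<Rightarrow> 'a) \<Rightarrow> 'a set" where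
  "inversions w = {b \<in> \<Delta>p. - w b \<in> \<Delta>p}"

lemma refl_neg_pos_iff:
  assumes "a \<in> P" "b \<in> R" "b \<noteq> a" "b \<noteq> - a"
  shows "- refl a b \<in> \<Delta>p \<longleftrightarrow> - b \<in> \<Delta>p"
proof -
  have "b \<in> \<Delta>p \<Longrightarrow> refl a b \<in> \<Delta>p" using assms refl_pos by blast
  moreover have "- b \<in> \<Delta>p \<Longrightarrow> - refl a b \<in> \<Delta>p"
    using assms refl_pos[of a "- b"] minus_equation_iff[of b a] by (auto simp: refl_minus_right)
  ultimately show ?thesis using pos_or_neg[OF assms(2)] pos_not_neg by blast
qed

text \<open>Composing with \<open>refl a\<close> on the left changes the sign of the image only for
  the roots sent to \<open>a\<close> or \<open>-a\<close>. Exactly one of these is positive, so the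
  inversion set gains or loses one element.\<close>

lemma card_inversions_refl_word:
  "set as \<subseteq> P \<Longrightarrow> even (card (inversions (refl_word as))) = even (length as)"
proof (induction as)
  case Nil
  have "inversions id = {}" using pos_not_neg by (auto simp: inversions_def)
  then show ?case by (simp only: refl_word_Nil) simp
next
  case (Cons a as)
  let ?w = "refl_word as"
  define d where "d = refl_word (rev as) a"
  have a: "a \<in> P" "set as \<subseteq> P" using Cons.prems by auto
  have wd: "?w d = a" by (simp add: d_def)
  have dR: "d \<in> R" unfolding d_def using a refl_word_root P_in_R by auto
  have neg: "?w (- x) = - ?w x" for x by (rule linear_neg[OF linear_refl_word])
  have inj: "?w x = ?w y \<Longrightarrow> x = y" for x y by (metis refl_word_rev_apply)
  have same: "- refl a (?w b) \<in> \<Delta>p \<longleftrightarrow> - ?w b \<in> \<Delta>p" if "b \<in> \<Delta>p" "b \<noteq> d" "b \<noteq> - d" for b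
  proof (rule refl_neg_pos_iff)
    show "?w b \<in> R" using that a refl_word_root pos_root_R by blast
    show "?w b \<noteq> a" using that wd inj by metis
    show "?w b \<noteq> - a" using that wd inj neg by metis
  qed (use a in auto)
  have ra: "refl a a = - a" using refl_self nonzero_root P_in_R a by blast
  have fin: "finite (inversions v)" for v using finite_pos by (simp add: inversions_def)
  have "even (card (inversions (refl_word (a # as)))) \<noteq> even (card (inversions ?w))"
  proof (cases "d \<in> \<Delta>p")
    case True
    then have "d \<notin> inversions ?w" using wd a P_pos pos_not_neg by (auto simp: inversions_def)
    moreover have "inversions (refl_word (a # as)) = insert d (inversions ?w)"
      using same True wd ra a P_pos pos_not_neg by (auto simp: inversions_def)
    ultimately show ?thesis using fin by simp
  next
    case False
    then have nd: "- d \<in> \<Delta>p" using pos_or_neg dR by blast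
    then have mem: "- d \<in> inversions ?w" using wd neg a P_pos by (auto simp: inversions_def)
    moreover have "- d \<notin> inversions (refl_word (a # as))"
      using wd neg ra a P_pos pos_not_neg by (auto simp: inversions_def refl_minus_right)
    moreover have "inversions ?w = insert (- d) (inversions (refl_word (a # as)))"
    proof (rule set_eqI)
      fix b
      show "b \<in> inversions ?w \<longleftrightarrow> b \<in> insert (- d) (inversions (refl_word (a # as)))"
        using mem same[of b] False by (cases "b = - d") (auto simp: inversions_def)
    qed
    ultimately show ?thesis using fin by simp
  qed
  then show ?case using Cons.IH[OF a(2)] by (simp only: length_Cons even_Suc) blast
qed

abbreviation sg :: "('a \<Rightarrow> 'a) \<Rightarrow> int poly" where "sg w \<equiv> (- 1) ^ wlen P w"

text \<open>A word attaining the minimum in \<open>wlen\<close> has the same composite, so its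
  length has the parity of the same inversion set. Any word may thus be used to compute the
  sign.\<close>

lemma sg_refl_word: "set as \<subseteq> P \<Longrightarrow> sg (refl_word as) = (- 1) ^ length as"
proof -
  assume as: "set as \<subseteq> P"
  let ?Q = "\<lambda>n. \<exists>bs. length bs = n \<and> set bs \<subseteq> P \<and> refl_word as = refl_word bs"
  have "wlen P (refl_word as) = (LEAST n. ?Q n)"
    by (simp add: wlen_def refl_word_def)
  moreover have "?Q (LEAST n. ?Q n)"
    by (rule LeastI[of ?Q "length as"]) (use as in blast)
  ultimately obtain bs where bs: "length bs = wlen P (refl_word as)" "set bs \<subseteq> P"
      "refl_word as = refl_word bs"
    by metis
  then have "even (length bs) = even (length as)"
    using card_inversions_refl_word[OF as] card_inversions_refl_word[OF bs(2)] by simp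
  then show ?thesis using bs(1) by (metis neg_one_even_power neg_one_odd_power)
qed

lemma sg_id: "sg id = 1"
  using sg_refl_word[of "[]"] by simp

lemma sg_refl_left: "a \<in> P \<Longrightarrow> w \<in> weyl R \<Longrightarrow> sg (refl a \<circ> w) = - sg w"
proof -
  assume a: "a \<in> P" and "w \<in> weyl R"
  then obtain as where "set as \<subseteq> P" "w = refl_word as" using weyl_cases by blast
  then show ?thesis using a sg_refl_word[of "a # as"] sg_refl_word[of as] by simp
qed

lemma sg_refl_right: "a \<in> P \<Longrightarrow> w \<in> weyl R \<Longrightarrow> sg (w \<circ> refl a) = - sg w"
proof -
  assume a: "a \<in> P" and "w \<in> weyl R"
  then obtain as where "set as \<subseteq> P" "w = refl_word as" using weyl_cases by blast
  then show ?thesis using a sg_refl_word[of "as @ [a]"] sg_refl_word[of as]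
    by (simp add: refl_word_append)
qed

section \<open>Alternating sums over the Weyl group\<close>

lemma weyl_refl_left: "a \<in> P \<Longrightarrow> w \<in> weyl R \<Longrightarrow> refl a \<circ> w \<in> weyl R"
  using weyl_step P_in_R by blast

lemma weyl_refl_right: "a \<in> P \<Longrightarrow> w \<in> weyl R \<Longrightarrow> w \<circ> refl a \<in> weyl R"
proof -
  assume a: "a \<in> P" and "w \<in> weyl R"
  then obtain as where "set as \<subseteq> P" "w = refl_word as" using weyl_cases by blast
  then show ?thesis using a refl_word_weyl[of "as @ [a]"] by (simp add: refl_word_append)
qed

lemma sum_weyl_refl_left:
  assumes "a \<in> P"
  shows "(\<Sum>w\<in>weyl R. sg w * f (refl a \<circ> w)) = - (\<Sum>w\<in>weyl R. sg w * f w)"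
proof -
  have "(\<Sum>w\<in>weyl R. sg w * f w) = (\<Sum>w\<in>weyl R. sg (refl a \<circ> w) * f (refl a \<circ> w))"
    by (rule sum.reindex_bij_witness[of _ "\<lambda>w. refl a \<circ> w" "\<lambda>w. refl a \<circ> w"])
      (use assms weyl_refl_left in \<open>auto simp: refl_comp_refl simp flip: comp_assoc\<close>)
  also have "\<dots> = (\<Sum>w\<in>weyl R. - (sg w * f (refl a \<circ> w)))"
    by (rule sum.cong) (use assms sg_refl_left in auto)
  finally show ?thesis by (simp add: sum_negf)
qed

lemma sum_weyl_refl_right:
  assumes "a \<in> P"
  shows "(\<Sum>w\<in>weyl R. sg w * f (w \<circ> refl a)) = - (\<Sum>w\<in>weyl R. sg w * f w)"
proof -
  have "(\<Sum>w\<in>weyl R. sg w * f w) = (\<Sum>w\<in>weyl R. sg (w \<circ> refl a) * f (w \<circ> refl a))"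
    by (rule sum.reindex_bij_witness[of _ "\<lambda>w. w \<circ> refl a" "\<lambda>w. w \<circ> refl a"])
      (use assms weyl_refl_right in \<open>auto simp: refl_comp_refl comp_assoc\<close>)
  also have "\<dots> = (\<Sum>w\<in>weyl R. - (sg w * f (w \<circ> refl a)))"
    by (rule sum.cong) (use assms sg_refl_right in auto)
  finally show ?thesis by (simp add: sum_negf)
qed

text \<open>The image of \<open>a\<close> under longer and longer suffixes starts positive and ends
  negative. Where it changes sign, at a letter \<open>c\<close>, the suffix sends \<open>a\<close>
  to \<open>c\<close>; hence \<open>refl c\<close> and the final \<open>refl a\<close>
  cancel.\<close>

lemma exchange:
  assumes "set as \<subseteq> P" "a \<in> P" "- refl_word as a \<in> \<Delta>p"
  shows "\<exists>bs. set bs \<subseteq> P \<and> Suc (length bs) = length as \<and> refl_word as \<circ> refl a = refl_word bs"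
  using assms
proof (induction as)
  case Nil
  then show ?case using P_pos pos_not_neg by auto
next
  case (Cons c as)
  have c: "c \<in> P" "set as \<subseteq> P" using Cons.prems by auto
  show ?case
  proof (cases "- refl_word as a \<in> \<Delta>p")
    case True
    then obtain bs where "set bs \<subseteq> P" "Suc (length bs) = length as"
        "refl_word as \<circ> refl a = refl_word bs"
      using Cons c by blast
    then show ?thesis
      using c by (intro exI[of _ "c # bs"]) (simp only: refl_word_Cons comp_assoc, simp)
  next
    case False
    have "refl_word as a \<in> R" using refl_word_root c Cons.prems P_in_R by blast
    then have pos: "refl_word as a \<in> \<Delta>p" using False pos_or_neg by blast
    have "refl_word as a = c"
    proof (rule ccontr)
      assume "refl_word as a \<noteq> c"
      then have "refl c (refl_word as a) \<in> \<Delta>p" using refl_pos c pos by blast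
      then show False using Cons.prems pos_not_neg by auto
    qed
    then have "refl c = refl_word as \<circ> refl a \<circ> refl_word (rev as)"
      using refl_conj_word by metis
    then have "refl_word (c # as) \<circ> refl a
        = refl_word as \<circ> (refl a \<circ> ((refl_word (rev as) \<circ> refl_word as) \<circ> refl a))"
      by (simp only: refl_word_Cons comp_assoc)
    also have "\<dots> = refl_word as"
      by (simp only: refl_word_rev id_comp refl_comp_refl comp_id)
    finally have "refl_word (c # as) \<circ> refl a = refl_word as" .
    moreover have "Suc (length as) = length (c # as)" by simp
    ultimately show ?thesis using c(2) by blast
  qed
qed

text \<open>In a nonempty word without inversions the last letter \<open>a\<close> is sent to a
  positive root, so the word without it sends \<open>a\<close> to a negative one. By
  \<open>exchange\<close> the composite has a word shorter by two letters.\<close>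

lemma refl_word_no_inversions:
  "set as \<subseteq> P \<Longrightarrow> inversions (refl_word as) = {} \<Longrightarrow> refl_word as = id"
proof (induction "length as" arbitrary: as rule: less_induct)
  case less
  show ?case
  proof (cases as rule: rev_cases)
    case (snoc bs a)
    have a: "a \<in> P" "set bs \<subseteq> P" using less.prems snoc by auto
    have w: "refl_word as = refl_word bs \<circ> refl a" using snoc by (simp add: refl_word_append)
    have "refl_word as a \<in> R" using refl_word_root less.prems a P_in_R by blast
    moreover have "- refl_word as a \<notin> \<Delta>p"
      using less.prems a P_pos by (auto simp: inversions_def)
    ultimately have "refl_word as a \<in> \<Delta>p" using pos_or_neg by blast
    moreover have "refl_word as a = - refl_word bs a"
      using w refl_self[OF nonzero_root[OF P_in_R[OF a(1)]]]
      by (simp add: linear_neg[OF linear_refl_word])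
    ultimately obtain cs where cs: "set cs \<subseteq> P" "Suc (length cs) = length bs"
        "refl_word as = refl_word cs"
      using exchange[OF a(2,1)] w by auto
    then have "length cs < length as" using snoc by simp
    then have "refl_word cs = id" using less.hyps[of cs] cs less.prems by simp
    then show ?thesis using cs by simp
  qed simp
qed

section \<open>Trivial stabilizers of regular dominant vectors\<close>

lemma inner_cone_nonneg:
  assumes "\<And>a. a \<in> P \<Longrightarrow> x \<bullet> a \<ge> 0" "\<And>a. a \<in> P \<Longrightarrow> cf y a \<ge> 0"
  shows "x \<bullet> y \<ge> 0"
proof -
  have "x \<bullet> y = (\<Sum>a\<in>P. cf y a * (x \<bullet> a))"
    by (subst cf_expand) (simp add: inner_sum_right)
  then show ?thesis using assms by (simp add: sum_nonneg)
qed

lemma inner_pos_root_pos: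
  assumes x: "\<And>a. a \<in> P \<Longrightarrow> x \<bullet> a > 0" and b: "b \<in> \<Delta>p"
  shows "x \<bullet> b > 0"
proof -
  obtain a where a: "a \<in> P" "cf b a \<noteq> 0"
    using cf_eqI[of b 0] zero_notin_R pos_root_R[OF b] by (metis cf_zero)
  have "x \<bullet> b = (\<Sum>a\<in>P. cf b a * (x \<bullet> a))"
    by (subst cf_expand) (simp add: inner_sum_right)
  also have "\<dots> > 0"
    by (rule sum_pos2[OF finite_P a(1)]) (use a cf_nonneg[OF b] x in \<open>force simp: less_le\<close>)+
  finally show ?thesis .
qed

text \<open>Orthogonality of \<open>w\<close> gives \<open>2 x \<bullet> y + y \<bullet> y = 0\<close> for \<open>y = w x - x\<close>,
  and both terms are nonnegative.\<close>

lemma weyl_regular_le: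
  assumes x: "\<And>a. a \<in> P \<Longrightarrow> x \<bullet> a > 0" and w: "w \<in> weyl R"
    and le: "\<And>a. a \<in> P \<Longrightarrow> cf (w x - x) a \<ge> 0"
  shows "w = id"
proof -
  obtain as where as: "set as \<subseteq> P" "w = refl_word as" using w weyl_cases by blast
  define y where "y = w x - x"
  have "x \<bullet> y \<ge> 0" using inner_cone_nonneg[of x y] x le unfolding y_def by (simp add: less_le)
  moreover have "(x + y) \<bullet> (x + y) = x \<bullet> x"
    using as by (simp add: y_def inner_refl_word)
  ultimately have "y \<bullet> y \<le> 0" by (simp add: inner_add_left inner_add_right inner_commute)
  then have "y = 0" by (metis inner_gt_zero_iff not_less)
  then have wx: "w x = x" by (simp add: y_def)
  \<comment> \<open>Since \<open>w\<close> fixes \<open>x\<close> and preserves inner products, an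
    inverted root \<open>b\<close> would have \<open>x \<bullet> b\<close> both positive and
    negative.\<close>
  have "inversions w = {}"
  proof (rule ccontr)
    assume "inversions w \<noteq> {}"
    then obtain b where b: "b \<in> \<Delta>p" "- w b \<in> \<Delta>p" by (auto simp: inversions_def)
    have "w x \<bullet> w b = x \<bullet> b" using as by (simp add: inner_refl_word)
    then show False
      using wx inner_pos_root_pos[OF x b(1)] inner_pos_root_pos[OF x b(2)] by simp
  qed
  then show ?thesis using refl_word_no_inversions as by simp
qed

end

section \<open>The partition function and the recurrences\<close>

definition partition_funs :: "'a::euclidean_space set \<Rightarrow> 'a \<Rightarrow> ('a \<Rightarrow> nat) set" where
  "partition_funs S x = {f. (\<forall>y. y \<notin> S \<longrightarrow> f y = 0) \<and> (\<Sum>a\<in>S. real (f a) *\<^sub>R a) = x}"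

text \<open>The partition function with the set of admissible parts as a parameter, so that a simple
  root can be removed from it.\<close>

definition partition_q :: "'a::euclidean_space set \<Rightarrow> 'a \<Rightarrow> int poly" where
  "partition_q S x = (\<Sum>f\<in>partition_funs S x. monom 1 (\<Sum>a\<in>S. f a))"

lemma kostant_q_eq: "kostant_q R P = partition_q (pos_roots R P)"
  by (rule ext) (simp add: kostant_q_def partition_q_def partition_funs_def)

text \<open>A linear involution permuting the parts turns partitions of \<open>x\<close> into
  partitions of \<open>r x\<close> with equally many parts.\<close>

lemma partition_q_bij:
  assumes bij: "bij_betw r S S" and lin: "linear r" and inv: "\<And>x. r (r x) = x"
  shows "partition_q S (r x) = partition_q S x"
proof -
  have mem: "r y \<in> S \<longleftrightarrow> y \<in> S" for y
    using bij inv by (metis bij_betwE)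
  have *: "f \<circ> r \<in> partition_funs S (r x)" if "f \<in> partition_funs S x" for f x
  proof -
    have "(\<Sum>a\<in>S. real (f (r a)) *\<^sub>R a) = (\<Sum>a\<in>S. real (f (r (r a))) *\<^sub>R r a)"
      by (rule sum.reindex_bij_betw[OF bij, symmetric])
    also have "\<dots> = r (\<Sum>a\<in>S. real (f a) *\<^sub>R a)"
      by (simp add: inv linear_sum[OF lin] linear_cmul[OF lin])
    finally show ?thesis using that mem by (auto simp: partition_funs_def)
  qed
  show ?thesis
    unfolding partition_q_def
  proof (rule sum.reindex_bij_witness[of _ "\<lambda>f. f \<circ> r" "\<lambda>f. f \<circ> r"])
    show "f \<circ> r \<in> partition_funs S x" if "f \<in> partition_funs S (r x)" for f
      using *[OF that] by (simp add: inv)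
    show "monom 1 (\<Sum>a\<in>S. (f \<circ> r) a) = monom 1 (\<Sum>a\<in>S. f a)" for f :: "'a \<Rightarrow> nat"
      using sum.reindex_bij_betw[OF bij, of f] by simp
  qed (use * in \<open>auto simp: fun_eq_iff inv\<close>)
qed

text \<open>A partition either avoids \<open>a\<close>, or arises by adding one copy of
  \<open>a\<close> to a partition of \<open>x - a\<close>, at the cost of one factor q. Finiteness
  is assumed because a sum over an infinite set is 0 by convention.\<close>

lemma partition_q_remove:
  assumes fin: "finite S" and a: "a \<in> S"
    and fin_x: "finite (partition_funs S x)"
  shows "partition_q S x = partition_q (S - {a}) x + monom 1 1 * partition_q S (x - a)"
proof -
  note split = sum.remove[OF fin a]
  have A: "{f \<in> partition_funs S x. f a = 0} = partition_funs (S - {a}) x"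
    by (auto simp: partition_funs_def split)
  have "partition_q (S - {a}) x = (\<Sum>f\<in>{f \<in> partition_funs S x. f a = 0}. monom 1 (\<Sum>a\<in>S. f a))"
    unfolding A partition_q_def by (rule sum.cong) (auto simp: split partition_funs_def)
  moreover have "monom 1 1 * partition_q S (x - a)
      = (\<Sum>f\<in>{f \<in> partition_funs S x. f a \<noteq> 0}. monom 1 (\<Sum>a\<in>S. f a))"
  proof -
    have "monom 1 1 * partition_q S (x - a) = (\<Sum>f\<in>partition_funs S (x - a). monom 1 (Suc (\<Sum>a\<in>S. f a)))"
      by (simp add: partition_q_def sum_distrib_left mult_monom)
    also have "\<dots> = (\<Sum>f\<in>{f \<in> partition_funs S x. f a \<noteq> 0}. monom 1 (\<Sum>a\<in>S. f a))"
    proof (rule sum.reindex_bij_witness[of _ "\<lambda>f. f(a := f a - 1)" "\<lambda>f. f(a := Suc (f a))"])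
      fix f assume "f \<in> {f \<in> partition_funs S x. f a \<noteq> 0}"
      then have f: "\<forall>y. y \<notin> S \<longrightarrow> f y = 0" "(\<Sum>a\<in>S. real (f a) *\<^sub>R a) = x" "f a \<noteq> 0"
        by (auto simp: partition_funs_def)
      have "(\<Sum>b\<in>S - {a}. real ((f(a := f a - 1)) b) *\<^sub>R b) = (\<Sum>b\<in>S - {a}. real (f b) *\<^sub>R b)"
        by (rule sum.cong) auto
      then have "(\<Sum>b\<in>S. real ((f(a := f a - 1)) b) *\<^sub>R b) = (\<Sum>b\<in>S. real (f b) *\<^sub>R b) - a"
        using f(3) unfolding split by (simp add: of_nat_diff scaleR_diff_left)
      then have "(\<Sum>b\<in>S. real ((f(a := f a - 1)) b) *\<^sub>R b) = x - a"
        unfolding f(2) .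
      moreover have "\<forall>y. y \<notin> S \<longrightarrow> (f(a := f a - 1)) y = 0" using f(1) by auto
      ultimately show "f(a := f a - 1) \<in> partition_funs S (x - a)"
        unfolding partition_funs_def by blast
    next
      fix f assume "f \<in> partition_funs S (x - a)"
      then have f: "\<forall>y. y \<notin> S \<longrightarrow> f y = 0" "(\<Sum>a\<in>S. real (f a) *\<^sub>R a) = x - a"
        by (auto simp: partition_funs_def)
      have "(\<Sum>b\<in>S - {a}. real ((f(a := Suc (f a))) b) *\<^sub>R b) = (\<Sum>b\<in>S - {a}. real (f b) *\<^sub>R b)"
        by (rule sum.cong) auto
      then have "(\<Sum>b\<in>S. real ((f(a := Suc (f a))) b) *\<^sub>R b) = a + (\<Sum>b\<in>S. real (f b) *\<^sub>R b)"
        unfolding split by (simp add: scaleR_add_left)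
      then have "(\<Sum>b\<in>S. real ((f(a := Suc (f a))) b) *\<^sub>R b) = x"
        unfolding f(2) by simp
      moreover have "\<forall>y. y \<notin> S \<longrightarrow> (f(a := Suc (f a))) y = 0" using f(1) a by auto
      moreover have "(f(a := Suc (f a))) a \<noteq> 0" by simp
      ultimately show "f(a := Suc (f a)) \<in> {f \<in> partition_funs S x. f a \<noteq> 0}"
        unfolding partition_funs_def by blast
      have "(\<Sum>b\<in>S - {a}. (f(a := Suc (f a))) b) = (\<Sum>b\<in>S - {a}. f b)"
        by (rule sum.cong) auto
      then have "(\<Sum>b\<in>S. (f(a := Suc (f a))) b) = Suc (\<Sum>b\<in>S. f b)"
        by (simp only: split fun_upd_same add_Suc)
      then show "monom 1 (\<Sum>b\<in>S. (f(a := Suc (f a))) b) = monom 1 (Suc (\<Sum>b\<in>S. f b))"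
        by (simp only:)
    qed (simp_all add: fun_upd_idem)
    finally show ?thesis .
  qed
  moreover have "partition_q S x = (\<Sum>f\<in>{f \<in> partition_funs S x. f a = 0}. monom 1 (\<Sum>a\<in>S. f a))
      + (\<Sum>f\<in>{f \<in> partition_funs S x. f a \<noteq> 0}. monom 1 (\<Sum>a\<in>S. f a))"
    unfolding partition_q_def using fin_x
    by (subst sum.union_disjoint[symmetric]) (auto intro!: sum.cong)
  ultimately show ?thesis by simp
qed

context based_root_system
begin

text \<open>Every part has height at least 1, so each multiplicity is bounded by the height of
  \<open>x\<close>.\<close>

lemma finite_partition_funs: "finite (partition_funs \<Delta>p x)"
proof (rule finite_subset)
  have "f b \<le> nat \<lfloor>hgt x\<rfloor>" if f: "f \<in> partition_funs \<Delta>p x" and b: "b \<in> \<Delta>p" for f b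
  proof -
    have "real (f b) \<le> real (f b) * hgt b"
      using hgt_pos[OF b] by (simp add: mult_le_cancel_left1)
    also have "\<dots> \<le> (\<Sum>a\<in>\<Delta>p. real (f a) * hgt a)"
      by (rule member_le_sum[OF b]) (simp_all add: hgt_nonneg finite_pos)
    also have "\<dots> = hgt x"
      using f by (auto simp: partition_funs_def hgt_sum hgt_scaleR)
    finally show ?thesis by linarith
  qed
  then show "partition_funs \<Delta>p x \<subseteq>
      {f. \<forall>b. (b \<in> \<Delta>p \<longrightarrow> f b \<in> {..nat \<lfloor>hgt x\<rfloor>}) \<and> (b \<notin> \<Delta>p \<longrightarrow> f b = 0)}"
    by (auto simp: partition_funs_def)
  show "finite {f. \<forall>b. (b \<in> \<Delta>p \<longrightarrow> f b \<in> {..nat \<lfloor>hgt x\<rfloor>}) \<and> (b \<notin> \<Delta>p \<longrightarrow> f b = (0::nat))}"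
    by (rule finite_set_of_finite_funs) (auto simp: finite_pos)
qed

lemma partition_q_remove_simple:
  "a \<in> P \<Longrightarrow> partition_q \<Delta>p x = partition_q (\<Delta>p - {a}) x + monom 1 1 * partition_q \<Delta>p (x - a)"
  by (rule partition_q_remove[OF finite_pos P_pos finite_partition_funs])

lemma partition_q_refl:
  "a \<in> P \<Longrightarrow> partition_q (\<Delta>p - {a}) (refl a x) = partition_q (\<Delta>p - {a}) x"
  by (rule partition_q_bij[OF refl_bij_pos linear_refl refl_refl])

lemma partition_q_eq_0:
  assumes "a \<in> P" "cf x a < 0"
  shows "partition_q \<Delta>p x = 0"
proof -
  have "cf (\<Sum>b\<in>\<Delta>p. real (f b) *\<^sub>R b) a \<ge> 0" for f
    using assms(1) cf_nonneg by (auto simp: cf_sum cf_scaleR intro!: sum_nonneg)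
  then have "partition_funs \<Delta>p x = {}"
    using assms(2) unfolding partition_funs_def by (metis (mono_tags, lifting) empty_Collect_eq not_le)
  then show ?thesis by (simp add: partition_q_def)
qed

lemma partition_q_0: "partition_q \<Delta>p 0 = 1"
proof -
  have "f = (\<lambda>_. 0)" if f: "f \<in> partition_funs \<Delta>p 0" for f
  proof
    fix b
    have "(\<Sum>a\<in>\<Delta>p. real (f a) * hgt a) = hgt (\<Sum>a\<in>\<Delta>p. real (f a) *\<^sub>R a)"
      by (simp add: hgt_sum hgt_scaleR)
    also have "\<dots> = 0" using f by (simp add: partition_funs_def hgt_zero)
    finally have "\<forall>a\<in>\<Delta>p. real (f a) * hgt a = 0"
      using sum_nonneg_eq_0_iff[OF finite_pos, of "\<lambda>a. real (f a) * hgt a"] hgt_nonneg by simp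
    then have "b \<in> \<Delta>p \<Longrightarrow> f b = 0" using hgt_pos[of b] by auto
    then show "f b = 0" using f by (auto simp: partition_funs_def)
  qed
  moreover have "(\<lambda>_. 0) \<in> partition_funs \<Delta>p 0" by (simp add: partition_funs_def)
  ultimately have "partition_funs \<Delta>p 0 = {\<lambda>_. 0}" by blast
  then show ?thesis by (simp add: partition_q_def)
qed

text \<open>\<open>lusztig_m\<close> without the shifts by \<rho>, which makes its antisymmetry in
  \<open>x\<close> under the ordinary Weyl group action visible.\<close>

definition alt_q :: "'a \<Rightarrow> 'a \<Rightarrow> int poly" where
  "alt_q x y = (\<Sum>w\<in>weyl R. sg w * partition_q \<Delta>p (w x - y))"

lemma lusztig_m_eq: "lusztig_m R P lam mu = alt_q (lam + rho R P) (mu + rho R P)"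
  by (simp add: lusztig_m_def alt_q_def kostant_q_eq)

lemma alt_q_refl: "a \<in> P \<Longrightarrow> alt_q (refl a x) y = - alt_q x y"
  using sum_weyl_refl_right[of a "\<lambda>w. partition_q \<Delta>p (w x - y)"] by (simp add: alt_q_def)

lemma alt_q_singular:
  assumes "a \<in> P" "coroot_pair x a = 0"
  shows "alt_q x y = 0"
proof -
  have "refl a x = x" using assms by (simp add: refl_def)
  then have "alt_q x y = - alt_q x y" using alt_q_refl[OF assms(1), of x y] by simp
  then show ?thesis using equal_neg_zero by blast
qed

text \<open>\<open>\<P>\<^sub>q(x) - q \<P>\<^sub>q(x - a)\<close> counts partitions into positive roots other than \<open>a\<close>,
  which the simple reflection in \<open>a\<close> permutes; hence the antisymmetry in \<open>y\<close>.\<close>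

lemma alt_q_antisym:
  assumes a: "a \<in> P"
  shows "alt_q x (refl a y) - monom 1 1 * alt_q x (refl a y + a)
       = - (alt_q x y - monom 1 1 * alt_q x (y + a))"
proof -
  have red: "alt_q x z - monom 1 1 * alt_q x (z + a)
      = (\<Sum>w\<in>weyl R. sg w * partition_q (\<Delta>p - {a}) (w x - z))" for z
  proof -
    have "partition_q (\<Delta>p - {a}) (w x - z)
        = partition_q \<Delta>p (w x - z) - monom 1 1 * partition_q \<Delta>p (w x - (z + a))" for w
      using partition_q_remove_simple[OF a, of "w x - z"] by (simp add: algebra_simps)
    then show ?thesis
      by (simp add: alt_q_def sum_distrib_left right_diff_distrib sum_subtractf mult.left_commute)
  qed
  have "(\<Sum>w\<in>weyl R. sg w * partition_q (\<Delta>p - {a}) (w x - refl a y))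
      = (\<Sum>w\<in>weyl R. sg w * partition_q (\<Delta>p - {a}) ((refl a \<circ> w) x - y))"
  proof (rule sum.cong[OF HOL.refl])
    fix w
    have "(refl a \<circ> w) x - y = refl a (w x - refl a y)" by (simp add: refl_diff refl_refl)
    then show "sg w * partition_q (\<Delta>p - {a}) (w x - refl a y)
        = sg w * partition_q (\<Delta>p - {a}) ((refl a \<circ> w) x - y)"
      using partition_q_refl[OF a] by (simp only:)
  qed
  also have "\<dots> = - (\<Sum>w\<in>weyl R. sg w * partition_q (\<Delta>p - {a}) (w x - y))"
    by (rule sum_weyl_refl_left[OF a])
  finally show ?thesis unfolding red .
qed

section \<open>Recurrences along simple roots\<close>

abbreviation lm :: "'a \<Rightarrow> 'a \<Rightarrow> int poly" where "lm \<equiv> lusztig_m R P"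

text \<open>This is \<open>alt_q_antisym\<close> at \<open>y = mu - a + rho R P\<close>: under
  \<open>refl a\<close> the changes of \<open>- a\<close> and of \<rho> cancel, leaving
  \<open>refl a mu + rho R P\<close>.\<close>

lemma lm_recurrence:
  assumes a: "a \<in> P"
  shows "lm lam (mu - a) + lm lam (refl a mu) = monom 1 1 * (lm lam mu + lm lam (refl a mu + a))"
proof -
  have "refl a (mu - a + rho R P) = refl a mu + rho R P"
    using refl_rho[OF a] refl_self[OF nonzero_root[OF P_in_R[OF a]]]
    by (simp add: refl_add refl_diff)
  moreover have "refl a mu + rho R P + a = refl a mu + a + rho R P"
    "mu - a + rho R P + a = mu + rho R P" by simp_all
  ultimately have "lm lam (refl a mu) - monom 1 1 * lm lam (refl a mu + a)
      = - (lm lam (mu - a) - monom 1 1 * lm lam mu)"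
    using alt_q_antisym[OF a, of "lam + rho R P" "mu - a + rho R P"]
    by (simp only: lusztig_m_eq)
  then show ?thesis by algebra
qed

text \<open>Here \<open>refl a mu = mu - a\<close>, so each side of the recurrence consists of two
  equal terms.\<close>

lemma lm_pair_1:
  assumes "a \<in> P" "coroot_pair mu a = 1"
  shows "lm lam (mu - a) = monom 1 1 * lm lam mu"
proof -
  have "refl a mu = mu - a" using assms by (simp add: refl_def)
  then have "2 * lm lam (mu - a) = 2 * (monom 1 1 * lm lam mu)"
    using lm_recurrence[OF assms(1), of lam mu] by (simp only: mult_2 diff_add_cancel distrib_left)
  then show ?thesis by (metis mult_cancel_left zero_neq_numeral)
qed

text \<open>The recurrence at \<open>mu = a\<close>, where \<open>mu - a\<close> and
  \<open>refl a mu + a\<close> are both 0.\<close>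

lemma lm_neg_simple:
  assumes "a \<in> P"
  shows "lm lam (- a) = [:-1, 1:] * lm lam 0 + monom 1 1 * lm lam a"
proof -
  have "refl a a = - a" using assms refl_self nonzero_root P_in_R by blast
  then have "lm lam 0 + lm lam (- a) = monom 1 1 * lm lam a + monom 1 1 * lm lam 0"
    using lm_recurrence[OF assms, of lam a]
    by (simp only: diff_self neg_eq_iff_add_eq_0[THEN iffD1] left_minus distrib_left)
  moreover have "[:-1, 1:] = monom 1 1 - (1 :: int poly)"
    by (simp add: monom_Suc one_pCons)
  ultimately show ?thesis
    by algebra
qed

section \<open>Values at and above the highest weight\<close>

lemma rho_inner_pos: "a \<in> P \<Longrightarrow> rho R P \<bullet> a > 0"
  using coroot_pair_rho[of a] coroot_pair_pos_iff[OF P_in_R, of a "rho R P"] by simp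

text \<open>A nonzero partition value puts \<open>w (lam + rho R P)\<close> above
  \<open>mu + rho R P\<close>, hence above \<open>lam + rho R P\<close>. The latter is regular
  dominant, so \<open>weyl_regular_le\<close> applies.\<close>

lemma weyl_dominant_le:
  assumes "\<And>a. a \<in> P \<Longrightarrow> lam \<bullet> a \<ge> 0" "w \<in> weyl R"
    and "\<And>a. a \<in> P \<Longrightarrow> cf mu a \<ge> cf lam a" 
    and "partition_q \<Delta>p (w (lam + rho R P) - (mu + rho R P)) \<noteq> 0"
  shows "w = id"
proof (rule weyl_regular_le[of "lam + rho R P"])
  fix a assume a: "a \<in> P"
  show "(lam + rho R P) \<bullet> a > 0"
    using assms(1)[OF a] rho_inner_pos[OF a] by (simp add: inner_add_left)
  have "cf (w (lam + rho R P) - (mu + rho R P)) a \<ge> 0"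
    using partition_q_eq_0[OF a] assms(4) by (meson not_less)
  then show "cf (w (lam + rho R P) - (lam + rho R P)) a \<ge> 0"
    using assms(3)[OF a] by (simp add: cf_diff cf_add)
qed (rule assms)

lemma lm_ge:
  assumes "\<And>a. a \<in> P \<Longrightarrow> lam \<bullet> a \<ge> 0" "\<And>a. a \<in> P \<Longrightarrow> cf mu a \<ge> cf lam a"
  shows "lm lam mu = partition_q \<Delta>p (lam - mu)"
proof -
  have "lm lam mu = (\<Sum>w\<in>weyl R. if w = id then partition_q \<Delta>p (lam - mu) else 0)"
    unfolding lusztig_m_eq alt_q_def
  proof (rule sum.cong[OF HOL.refl])
    fix w assume w: "w \<in> weyl R"
    show "sg w * partition_q \<Delta>p (w (lam + rho R P) - (mu + rho R P))
        = (if w = id then partition_q \<Delta>p (lam - mu) else 0)"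
    proof (cases "w = id")
      case True
      then show ?thesis by (simp only: sg_id id_apply if_True) simp
    next
      case False
      then have "partition_q \<Delta>p (w (lam + rho R P) - (mu + rho R P)) = 0"
        using weyl_dominant_le[OF assms(1) w assms(2)] by blast
      then show ?thesis using False by simp
    qed
  qed
  also have "\<dots> = partition_q \<Delta>p (lam - mu)"
    using weyl_id[of R] finite_weyl by simp
  finally show ?thesis .
qed

lemma lm_self: "(\<And>a. a \<in> P \<Longrightarrow> lam \<bullet> a \<ge> 0) \<Longrightarrow> lm lam lam = 1"
  using lm_ge[of lam lam] partition_q_0 by simp

lemma lm_0_pos:
  assumes "b \<in> \<Delta>p"
  shows "lm 0 b = 0"
proof -
  obtain a where a: "a \<in> P" "cf b a \<noteq> 0"
    using cf_eqI[of b 0] zero_notin_R pos_root_R[OF assms] by (metis cf_zero)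
  have "cf (0 - b) a < 0" using a cf_nonneg[OF assms a(1)] by (simp add: cf_minus)
  then show ?thesis
    using lm_ge[of 0 b] cf_nonneg[OF assms] partition_q_eq_0[OF a(1)] by (simp add: cf_zero)
qed

end

section \<open>Heights of short roots\<close>

text \<open>Gaussian elimination, one equation at a time. It will supply a kernel vector of the
  lowering map if a level were larger than the one below it.\<close>

lemma underdetermined_system:
  fixes M :: "'i \<Rightarrow> 'j \<Rightarrow> real"
  assumes "finite B" "finite A" "card B < card A"
  shows "\<exists>v. (\<exists>a\<in>A. v a \<noteq> 0) \<and> (\<forall>b\<in>B. (\<Sum>a\<in>A. v a * M a b) = 0)"
  using assms
proof (induction B arbitrary: A M rule: finite_induct)
  case empty
  then have "A \<noteq> {}" by auto
  then show ?case by (intro exI[of _ "\<lambda>_. 1"]) auto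
next
  case (insert b B)
  show ?case
  proof (cases "\<forall>a\<in>A. M a b = 0")
    case True
    have "card B < card A" using insert by simp
    then obtain v where "\<exists>a\<in>A. v a \<noteq> 0" "\<forall>c\<in>B. (\<Sum>a\<in>A. v a * M a c) = 0"
      using insert.IH[of A M] insert.prems by blast
    then show ?thesis using True by (intro exI[of _ v]) auto
  next
    case False
    then obtain a0 where a0: "a0 \<in> A" "M a0 b \<noteq> 0" by blast
    define r where "r a = M a b / M a0 b" for a
    have "card B < card (A - {a0})" using insert a0 by simp
    then obtain v where v: "\<exists>a\<in>A - {a0}. v a \<noteq> 0"
        "\<forall>c\<in>B. (\<Sum>a\<in>A - {a0}. v a * (M a c - r a * M a0 c)) = 0"
      using insert.IH[of "A - {a0}" "\<lambda>a c. M a c - r a * M a0 c"] insert.prems by blast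
    \<comment> \<open>The value at \<open>a0\<close> is the one that solves equation
      \<open>b\<close>; the other equations were already reduced by multiples \<open>r a\<close> of
      row \<open>a0\<close>.\<close>
    define v' where "v' = v(a0 := - (\<Sum>a\<in>A - {a0}. v a * r a))"
    have eq: "(\<Sum>a\<in>A. v' a * M a c) = (\<Sum>a\<in>A - {a0}. v a * (M a c - r a * M a0 c))" for c
    proof -
      have "(\<Sum>a\<in>A. v' a * M a c) = v' a0 * M a0 c + (\<Sum>a\<in>A - {a0}. v' a * M a c)"
        by (rule sum.remove[OF insert.prems(1) a0(1)])
      also have "(\<Sum>a\<in>A - {a0}. v' a * M a c) = (\<Sum>a\<in>A - {a0}. v a * M a c)"
        by (rule sum.cong) (auto simp: v'_def)
      finally show ?thesis
        by (simp add: v'_def sum_distrib_right right_diff_distrib sum_subtractf mult.assoc)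
    qed
    have "(\<Sum>a\<in>A. v' a * M a b) = 0"
      unfolding eq using a0(2) by (simp add: r_def)
    moreover have "\<exists>a\<in>A. v' a \<noteq> 0" using v(1) by (auto simp: v'_def)
    moreover have "\<forall>c\<in>B. (\<Sum>a\<in>A. v' a * M a c) = 0" unfolding eq by (rule v(2))
    ultimately show ?thesis by blast
  qed
qed

text \<open>Give the cell (i, j) of the diagram \<open>j \<le> n i\<close> the weight q^i - q^(i-1).
  Summing over j first yields the sum over \<open>S\<close> grouped by \<open>h\<close>. Summing
  over i first telescopes to q^e - 1, because monotonicity makes the admissible i an initial segment
  \<open>{1..e}\<close>.\<close>

lemma sum_conjugate_partition:
  fixes n :: "nat \<Rightarrow> nat" and h :: "'b \<Rightarrow> nat"
  assumes fin: "finite S" and h1: "\<And>x. x \<in> S \<Longrightarrow> h x \<ge> 1"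
    and n: "\<And>i. i \<ge> 1 \<Longrightarrow> n i = card {x \<in> S. h x = i}"
    and mono: "\<And>i. i \<ge> 1 \<Longrightarrow> n (Suc i) \<le> n i"
  shows "(\<Sum>j=1..n 1. monom 1 (card {i. 1 \<le> i \<and> j \<le> n i}) :: int poly)
       = of_nat (n 1) + (\<Sum>x\<in>S. monom 1 (h x - 1) * [:-1, 1:])"
proof -
  define D :: "nat \<Rightarrow> int poly" where "D i = monom 1 (i - 1) * [:-1, 1:]" for i
  have D: "D (Suc i) = monom 1 (Suc i) - monom 1 i" for i
  proof -
    have "[:-1, 1:] = monom 1 1 - (1 :: int poly)" by (simp add: monom_Suc one_pCons)
    then show ?thesis by (simp only: D_def right_diff_distrib mult_monom) simp
  qed
  have tele: "(\<Sum>i=1..e. D i) = monom 1 e - 1" for e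
  proof (induction e)
    case (Suc e)
    then show ?case by (simp add: D)
  qed simp
  \<comment> \<open>Inserting 0 keeps the maximum meaningful for empty \<open>S\<close>.\<close>
  define B where "B = Max (insert 0 (h ` S))"
  have hB: "h x \<le> B" if "x \<in> S" for x
    unfolding B_def using fin that by (intro Max_ge) auto
  have nB: "n i = 0" if "i > B" for i
  proof -
    have "{x \<in> S. h x = i} = {}" using hB that by fastforce
    then show ?thesis using n[of i] that by (simp only: card.empty)
  qed
  have anti: "n i' \<le> n i" if "1 \<le> i" "i \<le> i'" for i i'
    using that(2,1)
  proof (induction rule: dec_induct)
    case (step k)
    then show ?case using mono[of k] by simp
  qed simp
  have E: "(\<Sum>i | 1 \<le> i \<and> j \<le> n i. D i) = monom 1 (card {i. 1 \<le> i \<and> j \<le> n i}) - 1"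
    if "j \<ge> 1" for j
  proof -
    let ?E = "{i. 1 \<le> i \<and> j \<le> n i}"
    have sub: "?E \<subseteq> {1..B}"
    proof
      fix i assume i: "i \<in> ?E"
      then have "\<not> B < i" using nB[of i] that by auto
      then show "i \<in> {1..B}" using i by simp
    qed
    have "\<exists>e. ?E = {1..e}"
    proof (cases "?E = {}")
      case True
      then show ?thesis by (intro exI[of _ 0]) auto
    next
      case False
      have fE: "finite ?E" using sub finite_subset by blast
      define e where "e = Max ?E"
      have e: "1 \<le> e" "j \<le> n e" using Max_in[OF fE False] unfolding e_def by auto
      have "i \<le> e" if "i \<in> ?E" for i using Max_ge[OF fE that] unfolding e_def .
      then have "?E \<subseteq> {1..e}" by auto
      moreover have "{1..e} \<subseteq> ?E"
        using anti[of _ e] e(2) by (auto intro: order_trans)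
      ultimately show ?thesis by blast
    qed
    then obtain e where e: "?E = {1..e}" by blast
    show ?thesis unfolding e tele by simp
  qed
  have "(\<Sum>x\<in>S. D (h x)) = (\<Sum>i\<in>{1..B}. of_nat (card {x \<in> S. h x = i}) * D i)"
    by (rule sum_fun_comp) (use fin h1 hB in auto)
  also have "\<dots> = (\<Sum>i\<in>{1..B}. \<Sum>j=1..n 1. if j \<le> n i then D i else 0)"
  proof (rule sum.cong[OF HOL.refl])
    fix i assume i: "i \<in> {1..B}"
    then have "{j \<in> {1..n 1}. j \<le> n i} = {1..n i}" using anti[of 1 i] by auto
    then have "(\<Sum>j=1..n 1. if j \<le> n i then D i else 0) = (\<Sum>j=1..n i. D i)"
      by (simp only: sum.inter_filter[OF finite_atLeastAtMost, symmetric])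
    then show "of_nat (card {x \<in> S. h x = i}) * D i = (\<Sum>j=1..n 1. if j \<le> n i then D i else 0)"
      using n[of i] i by simp
  qed
  also have "\<dots> = (\<Sum>j=1..n 1. \<Sum>i\<in>{1..B}. if j \<le> n i then D i else 0)"
    by (rule sum.swap)
  also have "\<dots> = (\<Sum>j=1..n 1. monom 1 (card {i. 1 \<le> i \<and> j \<le> n i}) - 1)"
  proof (rule sum.cong[OF HOL.refl])
    fix j assume j: "j \<in> {1..n 1}"
    have "i \<le> B" if "j \<le> n i" for i
      using nB[of i] that j by (cases "B < i") auto
    then have "{i \<in> {1..B}. j \<le> n i} = {i. 1 \<le> i \<and> j \<le> n i}" by auto
    then have "(\<Sum>i\<in>{1..B}. if j \<le> n i then D i else 0) = (\<Sum>i | 1 \<le> i \<and> j \<le> n i. D i)"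
      by (simp only: sum.inter_filter[OF finite_atLeastAtMost, symmetric])
    then show "(\<Sum>i\<in>{1..B}. if j \<le> n i then D i else 0)
        = monom 1 (card {i. 1 \<le> i \<and> j \<le> n i}) - 1"
      using E j by simp
  qed
  finally show ?thesis unfolding D_def[symmetric] by (simp add: sum_subtractf)
qed

context based_root_system
begin

section \<open>Short roots and their pairings\<close>

abbreviation Sh :: "'a set" where "Sh \<equiv> short_roots R"

abbreviation Sp :: "'a set" where "Sp \<equiv> short_roots R \<inter> \<Delta>p"

lemma short_R: "g \<in> Sh \<Longrightarrow> g \<in> R"
  by (simp add: short_roots_def)

lemma finite_Sh: "finite Sh"
  using finite_R by (simp add: short_roots_def)

lemma finite_Sp: "finite Sp"
  using finite_Sh by simp

lemma short_refl: "g \<in> Sh \<Longrightarrow> a \<in> R \<Longrightarrow> refl a g \<in> Sh"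
  by (simp add: short_roots_def inner_refl refl_in_R)

lemma short_minus: "g \<in> Sh \<Longrightarrow> - g \<in> Sh"
  by (simp add: short_roots_def uminus_root)

lemma short_refl_word: "set as \<subseteq> P \<Longrightarrow> g \<in> Sh \<Longrightarrow> refl_word as g \<in> Sh"
  by (induction as) (auto intro: short_refl P_in_R)

text \<open>As \<open>R\<close> is reduced, \<open>g\<close> and \<open>b\<close> are not
  proportional, so Cauchy-Schwarz is strict; with \<open>norm g \<le> norm b\<close> the integer
  \<open>coroot_pair g b\<close> has absolute value below 2.\<close>

lemma short_pair:
  assumes g: "g \<in> Sh" and b: "b \<in> R" "g \<noteq> b" "g \<noteq> - b"
  shows "coroot_pair g b \<in> {-1, 0, 1}"
proof -
  have gR: "g \<in> R" using g short_R by blast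
  have nz: "norm g > 0" "norm b > 0" using gR b nonzero_root by auto
  have "\<bar>g \<bullet> b\<bar> \<noteq> norm g * norm b"
  proof
    assume "\<bar>g \<bullet> b\<bar> = norm g * norm b"
    then have "norm g *\<^sub>R b = norm b *\<^sub>R g \<or> norm g *\<^sub>R b = - norm b *\<^sub>R g"
      by (simp add: norm_cauchy_schwarz_abs_eq)
    then have "\<exists>c. b = c *\<^sub>R g"
    proof
      assume "norm g *\<^sub>R b = norm b *\<^sub>R g"
      then have "b = (norm b / norm g) *\<^sub>R g"
        using nz by (metis (no_types, lifting) divideR_right divide_inverse_commute less_irrefl scaleR_scaleR)
      then show ?thesis by blast
    next
      assume "norm g *\<^sub>R b = - norm b *\<^sub>R g"
      then have "b = (- norm b / norm g) *\<^sub>R g"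
        using nz by (metis (no_types, lifting) divideR_right divide_inverse_commute less_irrefl scaleR_scaleR)
      then show ?thesis by blast
    qed
    then obtain c where "b = c *\<^sub>R g" by blast
    then have "b = g \<or> b = - g" using reduced[OF gR, of c] b(1) by auto
    then show False using b by auto
  qed
  then have "\<bar>g \<bullet> b\<bar> < norm g * norm b" using Cauchy_Schwarz_ineq2[of g b] by linarith
  also have "norm g \<le> norm b" using g b by (simp add: short_roots_def norm_le)
  then have "norm g * norm b \<le> b \<bullet> b"
    using nz by (simp add: dot_square_norm power2_eq_square mult_right_mono)
  finally have "\<bar>coroot_pair g b\<bar> < 2"
    using nz by (simp add: coroot_pair_def abs_mult divide_less_eq)
  moreover have "coroot_pair g b \<in> \<int>" using coroot_pair_Ints gR b by blast
  ultimately obtain z where z: "coroot_pair g b = real_of_int z" "\<bar>z\<bar> < 2"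
    by (auto elim!: Ints_cases)
  then have "z = -1 \<or> z = 0 \<or> z = 1" by arith
  then show ?thesis using z by auto
qed

lemma pos_neq_neg: "g \<in> \<Delta>p \<Longrightarrow> a \<in> \<Delta>p \<Longrightarrow> g \<noteq> - a"
  using pos_not_neg by auto

lemma short_pair_simple:
  "g \<in> Sp \<Longrightarrow> a \<in> P \<Longrightarrow> g \<noteq> a \<Longrightarrow> coroot_pair g a \<in> {-1, 0, 1}"
  using short_pair[of g a] P_in_R P_pos pos_neq_neg by blast

text \<open>With pairing -1 the sum \<open>g + a\<close> is just \<open>refl a g\<close>, hence
  again short and positive.\<close>

lemma short_up:
  assumes "g \<in> Sp" "a \<in> P" "coroot_pair g a = -1"
  shows "g + a \<in> Sp" "hgt (g + a) = hgt g + 1"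
proof -
  have "g \<noteq> a" using assms coroot_pair_self[of a] nonzero_root P_in_R by force
  then have "refl a g \<in> Sp" using assms refl_pos short_refl P_in_R by blast
  then show "g + a \<in> Sp" using assms(3) by (simp add: refl_def)
qed (use assms in \<open>simp add: hgt_add hgt_base\<close>)

lemma short_down:
  assumes "g \<in> Sp" "a \<in> P" "coroot_pair g a = 1"
  shows "g - a \<in> Sp" "hgt (g - a) = hgt g - 1"
proof -
  have "g \<noteq> a" using assms coroot_pair_self[of a] nonzero_root P_in_R by force
  then have "refl a g \<in> Sp" using assms refl_pos short_refl P_in_R by blast
  then show "g - a \<in> Sp" using assms(3) by (simp add: refl_def)
qed (use assms in \<open>simp add: hgt_diff hgt_base\<close>)

lemma short_not_simple_down:
  assumes g: "g \<in> Sp" "g \<notin> P"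
  shows "\<exists>a\<in>P. coroot_pair g a = 1"
proof -
  obtain a where a: "a \<in> P" "g \<bullet> a > 0" using g exists_simple_inner_pos by blast
  then have "coroot_pair g a > 0" using coroot_pair_pos_iff P_in_R by blast
  then show ?thesis using short_pair_simple[OF g(1) a(1)] a g by auto
qed

text \<open>If the product were positive, the positive root \<open>refl b a\<close> would have a
  negative coordinate at \<open>b\<close>.\<close>

lemma simple_inner_nonpos:
  assumes "a \<in> P" "b \<in> P" "a \<noteq> b"
  shows "a \<bullet> b \<le> 0"
proof -
  have "refl b a \<in> \<Delta>p" using assms refl_pos P_pos by blast
  then have "cf (refl b a) b \<ge> 0" using cf_nonneg assms by blast
  then have "\<not> coroot_pair a b > 0"
    using assms by (simp add: refl_def cf_diff cf_scaleR cf_base)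
  then show ?thesis using coroot_pair_pos_iff[of b a] P_in_R[OF assms(2)] by simp
qed

lemma simple_pair_nonpos: "a \<in> P \<Longrightarrow> b \<in> P \<Longrightarrow> a \<noteq> b \<Longrightarrow> coroot_pair a b \<le> 0"
  using simple_inner_nonpos[of a b] coroot_pair_pos_iff[of b a] P_in_R[of b] by (meson not_le)

lemma dominant_root_iff: "t \<in> R \<Longrightarrow> t \<in> dominant R P \<longleftrightarrow> (\<forall>a\<in>P. t \<bullet> a \<ge> 0)"
  using coroot_pair_Ints coroot_pair_nonneg_iff P_in_R by (auto simp: dominant_def weights_def)

lemma dominant_root_pos:
  assumes "t \<in> R" "\<And>a. a \<in> P \<Longrightarrow> t \<bullet> a \<ge> 0"
  shows "t \<in> \<Delta>p"
proof (rule ccontr)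
  assume "t \<notin> \<Delta>p"
  then have "- t \<in> \<Delta>p" using pos_or_neg assms by blast
  then have "t \<bullet> (- t) \<ge> 0" using inner_cone_nonneg[of t "- t"] assms cf_nonneg by blast
  moreover have "t \<bullet> t > 0" using nonzero_root[OF assms(1)] by simp
  ultimately show False by simp
qed

text \<open>The \<open>c\<^sub>a\<close> are the coordinates of the half sum of positive coroots in the simple coroots.\<close>

lemma hgt_eq_coroot_sum:
  obtains c where "\<And>a. a \<in> P \<Longrightarrow> c a \<ge> 0" "\<And>x. hgt x = (\<Sum>a\<in>P. c a * coroot_pair x a)"
proof
  let ?c = "\<lambda>a. cf rho_dual a * (a \<bullet> a) / 2"
  show "?c a \<ge> 0" if "a \<in> P" for a
    unfolding rho_dual_def using that cf_nonneg
    by (auto simp: cf_sum cf_scaleR intro!: mult_nonneg_nonneg sum_nonneg divide_nonneg_nonneg)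
  show "hgt x = (\<Sum>a\<in>P. ?c a * coroot_pair x a)" for x
  proof -
    have "hgt x = (\<Sum>a\<in>P. cf rho_dual a * (x \<bullet> a))"
      unfolding hgt_def by (subst cf_expand[of rho_dual]) (simp add: inner_sum_right)
    also have "\<dots> = (\<Sum>a\<in>P. ?c a * coroot_pair x a)"
      using nonzero_root[OF P_in_R] by (intro sum.cong) (auto simp: coroot_pair_def)
    finally show ?thesis .
  qed
qed

section \<open>Monotonicity of the number of short roots of given height\<close>

definition level :: "nat \<Rightarrow> 'a set" where
  "level i = {g \<in> Sp. hgt g = real i}"

lemma finite_level: "finite (level i)"
  by (rule finite_subset[OF _ finite_Sp]) (auto simp: level_def)

lemma level_not_simple: "g \<in> level i \<Longrightarrow> i \<ge> 2 \<Longrightarrow> a \<in> P \<Longrightarrow> g \<noteq> a"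
  using hgt_base by (auto simp: level_def)

lemma level_up: "g \<in> level i \<Longrightarrow> a \<in> P \<Longrightarrow> coroot_pair g a = -1 \<Longrightarrow> g + a \<in> level (Suc i)"
  using short_up[of g a] by (auto simp: level_def)

lemma level_down: "g \<in> level (Suc i) \<Longrightarrow> a \<in> P \<Longrightarrow> coroot_pair g a = 1 \<Longrightarrow> g - a \<in> level i"
  using short_down[of g a] by (auto simp: level_def)

text \<open>The root \<open>g + a\<close> has height at least 2, so it differs from \<open>b\<close>
  and pairs with it to at least -1. That pairing is -1 plus the nonpositive
  \<open>coroot_pair a b\<close>, which must therefore vanish.\<close>

lemma level_diamond_up:
  assumes g: "g \<in> level i" "i \<ge> 1" and ab: "a \<in> P" "b \<in> P" "a \<noteq> b"
    and "coroot_pair g a = -1" "coroot_pair g b = -1"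
  shows "coroot_pair a b = 0"
proof -
  have "g + a \<in> level (Suc i)" using level_up assms by blast
  then have "g + a \<in> Sp" "g + a \<noteq> b" using level_not_simple[of "g + a" "Suc i" b] g ab by (auto simp: level_def)
  then have "coroot_pair (g + a) b \<in> {-1, 0, 1}" using short_pair_simple ab by blast
  then show ?thesis using assms simple_pair_nonpos[OF ab] by (auto simp: coroot_pair_add)
qed

text \<open>Dual to the upward case. The bound \<open>i \<ge> 2\<close> keeps \<open>g - a\<close>
  from being the simple root \<open>b\<close>, where the pairing would be 2.\<close>

lemma level_diamond_down:
  assumes g: "g \<in> level (Suc i)" "i \<ge> 2" and ab: "a \<in> P" "b \<in> P" "a \<noteq> b"
    and "coroot_pair g a = 1" "coroot_pair g b = 1"
  shows "coroot_pair a b = 0"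
proof -
  have "g - a \<in> level i" using level_down assms by blast
  then have "g - a \<in> Sp" "g - a \<noteq> b" using level_not_simple[of "g - a" i b] g ab by (auto simp: level_def)
  then have "coroot_pair (g - a) b \<in> {-1, 0, 1}" using short_pair_simple ab by blast
  then show ?thesis using assms simple_pair_nonpos[OF ab] by (auto simp: coroot_pair_diff)
qed

lemma coroot_pair_eq_0_commute: "coroot_pair a b = 0 \<Longrightarrow> b \<in> R \<Longrightarrow> coroot_pair b a = 0"
  using nonzero_root[of b] by (auto simp: coroot_pair_def inner_commute)

text \<open>The maps \<open>E\<close> and \<open>F = E\<^sup>T\<close>, raising and lowering by simple roots with weights \<open>\<surd>c\<^sub>a\<close>, satisfy
  \<open>[E, F] = ht\<close> on short roots of height at least 2, as in the principal \<open>sl\<^sub>2\<close>.  Hence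
  \<open>|F v|\<^sup>2 = |E v|\<^sup>2 + \<Sum> ht(g) v(g)\<^sup>2\<close>, so \<open>F\<close> is injective on each such level.\<close>

lemma card_level_mono:
  assumes i: "i \<ge> 1"
  shows "card (level (Suc i)) \<le> card (level i)"
proof (rule ccontr)
  assume "\<not> ?thesis"
  then have less: "card (level i) < card (level (Suc i))" by simp
  obtain c where c0: "\<And>a. a \<in> P \<Longrightarrow> c a \<ge> 0"
    and c: "\<And>x. hgt x = (\<Sum>a\<in>P. c a * coroot_pair x a)"
    by (rule hgt_eq_coroot_sum) blast
  define s where "s a = sqrt (c a)" for a
  \<comment> \<open>A nonzero vector with F v = 0: the unknowns are indexed by
    \<open>level (Suc i)\<close>, the equations by the smaller \<open>level i\<close>.\<close>
  obtain v where v: "\<exists>g\<in>level (Suc i). v g \<noteq> 0"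
    and Mv: "\<forall>d\<in>level i. (\<Sum>g\<in>level (Suc i). v g *
        (\<Sum>a\<in>P. if coroot_pair d a = -1 \<and> g = d + a then s a else 0)) = 0"
    using underdetermined_system[OF finite_level finite_level less,
        of "\<lambda>g d. \<Sum>a\<in>P. if coroot_pair d a = -1 \<and> g = d + a then s a else 0"] by blast
  \<comment> \<open>\<open>FF a b\<close> and \<open>EE a b\<close> are the (a, b) parts of |F v|^2
    and |E v|^2, without the factor \<open>s a * s b\<close>.\<close>
  define Fset where "Fset a b = {d \<in> level i. coroot_pair d a = -1 \<and> coroot_pair d b = -1}" for a b
  define Eset where "Eset a b = {e \<in> level (Suc (Suc i)). coroot_pair e a = 1 \<and> coroot_pair e b = 1}" for a b
  define FF where "FF a b = (\<Sum>d\<in>Fset a b. v (d + a) * v (d + b))" for a b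
  define EE where "EE a b = (\<Sum>e\<in>Eset a b. v (e - a) * v (e - b))" for a b
  have Fv: "(\<Sum>a\<in>P. if coroot_pair d a = -1 then s a * v (d + a) else 0) = 0" if d: "d \<in> level i" for d
  proof -
    have "0 = (\<Sum>g\<in>level (Suc i). \<Sum>a\<in>P. if coroot_pair d a = -1 \<and> g = d + a then v g * s a else 0)"
      using Mv d by (simp add: sum_distrib_left if_distrib[of "(*) _"] cong: if_cong)
    also have "\<dots> = (\<Sum>a\<in>P. \<Sum>g\<in>level (Suc i). if coroot_pair d a = -1 \<and> g = d + a then v g * s a else 0)"
      by (rule sum.swap)
    also have "\<dots> = (\<Sum>a\<in>P. if coroot_pair d a = -1 then s a * v (d + a) else 0)"
    proof (rule sum.cong[OF HOL.refl])
      fix a assume a: "a \<in> P"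
      show "(\<Sum>g\<in>level (Suc i). if coroot_pair d a = -1 \<and> g = d + a then v g * s a else 0)
          = (if coroot_pair d a = -1 then s a * v (d + a) else 0)"
        using level_up[OF d a] finite_level by (cases "coroot_pair d a = -1") auto
    qed
    finally show ?thesis by simp
  qed
  have "(\<Sum>a\<in>P. \<Sum>b\<in>P. s a * s b * FF a b)
      = (\<Sum>d\<in>level i. (\<Sum>a\<in>P. if coroot_pair d a = -1 then s a * v (d + a) else 0)\<^sup>2)"
  proof -
    have "(\<Sum>a\<in>P. \<Sum>b\<in>P. s a * s b * FF a b) = (\<Sum>a\<in>P. \<Sum>b\<in>P. \<Sum>d\<in>level i.
        (if coroot_pair d a = -1 then s a * v (d + a) else 0) *
        (if coroot_pair d b = -1 then s b * v (d + b) else 0))"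
      unfolding FF_def Fset_def sum_distrib_left
      by (intro sum.cong[OF HOL.refl], subst sum.inter_filter[OF finite_level])
        (auto intro!: sum.cong simp: mult_ac)
    also have "\<dots> = (\<Sum>a\<in>P. \<Sum>d\<in>level i. \<Sum>b\<in>P.
        (if coroot_pair d a = -1 then s a * v (d + a) else 0) *
        (if coroot_pair d b = -1 then s b * v (d + b) else 0))"
      by (rule sum.cong[OF HOL.refl], rule sum.swap)
    also have "\<dots> = (\<Sum>d\<in>level i. \<Sum>a\<in>P. \<Sum>b\<in>P.
        (if coroot_pair d a = -1 then s a * v (d + a) else 0) *
        (if coroot_pair d b = -1 then s b * v (d + b) else 0))"
      by (rule sum.swap)
    finally show ?thesis by (simp only: power2_eq_square sum_product)
  qed
  then have F0: "(\<Sum>a\<in>P. \<Sum>b\<in>P. s a * s b * FF a b) = 0" using Fv by simp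
  have "(\<Sum>a\<in>P. \<Sum>b\<in>P. s a * s b * EE a b)
      = (\<Sum>e\<in>level (Suc (Suc i)). (\<Sum>a\<in>P. if coroot_pair e a = 1 then s a * v (e - a) else 0)\<^sup>2)"
  proof -
    have "(\<Sum>a\<in>P. \<Sum>b\<in>P. s a * s b * EE a b) = (\<Sum>a\<in>P. \<Sum>b\<in>P. \<Sum>e\<in>level (Suc (Suc i)).
        (if coroot_pair e a = 1 then s a * v (e - a) else 0) *
        (if coroot_pair e b = 1 then s b * v (e - b) else 0))"
      unfolding EE_def Eset_def sum_distrib_left
      by (intro sum.cong[OF HOL.refl], subst sum.inter_filter[OF finite_level])
        (auto intro!: sum.cong simp: mult_ac)
    also have "\<dots> = (\<Sum>a\<in>P. \<Sum>e\<in>level (Suc (Suc i)). \<Sum>b\<in>P.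
        (if coroot_pair e a = 1 then s a * v (e - a) else 0) *
        (if coroot_pair e b = 1 then s b * v (e - b) else 0))"
      by (rule sum.cong[OF HOL.refl], rule sum.swap)
    also have "\<dots> = (\<Sum>e\<in>level (Suc (Suc i)). \<Sum>a\<in>P. \<Sum>b\<in>P.
        (if coroot_pair e a = 1 then s a * v (e - a) else 0) *
        (if coroot_pair e b = 1 then s b * v (e - b) else 0))"
      by (rule sum.swap)
    finally show ?thesis by (simp only: power2_eq_square sum_product)
  qed
  then have E0: "(\<Sum>a\<in>P. \<Sum>b\<in>P. s a * s b * EE a b) \<ge> 0" by (simp add: sum_nonneg)
  have pair_simple: "coroot_pair a a = 2" if "a \<in> P" for a
    using that coroot_pair_self nonzero_root P_in_R by blast
  \<comment> \<open>Off the diagonal the diamond \<open>d, d + a, d + b, d + a + b\<close> matches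
    terms: its bottom indexes a term of \<open>FF\<close>, its top the same product in
    \<open>EE\<close>.\<close>
  have off: "FF a b = EE a b" if ab: "a \<in> P" "b \<in> P" "a \<noteq> b" for a b
    unfolding FF_def EE_def
  proof (rule sum.reindex_bij_witness[of _ "\<lambda>e. e - a - b" "\<lambda>d. d + a + b"])
    fix d assume "d \<in> Fset a b"
    then have d: "d \<in> level i" "coroot_pair d a = -1" "coroot_pair d b = -1" by (auto simp: Fset_def)
    have orth: "coroot_pair a b = 0" using level_diamond_up[OF d(1) i ab d(2,3)] .
    then have orth': "coroot_pair b a = 0" using coroot_pair_eq_0_commute ab P_in_R by blast
    have "d + a + b \<in> level (Suc (Suc i))"
      using level_up[OF level_up[OF d(1) ab(1) d(2)] ab(2)] d orth by (simp add: coroot_pair_add)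
    then show "d + a + b \<in> Eset a b"
      using d orth orth' ab pair_simple by (simp add: Eset_def coroot_pair_add)
  next
    fix e assume "e \<in> Eset a b"
    then have e: "e \<in> level (Suc (Suc i))" "coroot_pair e a = 1" "coroot_pair e b = 1" by (auto simp: Eset_def)
    have orth: "coroot_pair a b = 0" using level_diamond_down[OF e(1) _ ab e(2,3)] i by simp
    then have orth': "coroot_pair b a = 0" using coroot_pair_eq_0_commute ab P_in_R by blast
    have "e - a - b \<in> level i"
      using level_down[OF level_down[OF e(1) ab(1) e(2)] ab(2)] e orth by (simp add: coroot_pair_diff)
    then show "e - a - b \<in> Fset a b"
      using e orth orth' ab pair_simple by (simp add: Fset_def coroot_pair_diff)
  qed (auto simp: algebra_simps)
  \<comment> \<open>On the diagonal \<open>FF\<close> sees the \<open>g\<close> with pairing 1 and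
    \<open>EE\<close> those with pairing -1. Height at least 2 excludes \<open>g = a\<close>, so no
    other nonzero pairing occurs.\<close>
  have diag: "FF a a - EE a a = (\<Sum>g\<in>level (Suc i). coroot_pair g a * (v g)\<^sup>2)" if a: "a \<in> P" for a
  proof -
    have "FF a a = (\<Sum>g\<in>{g \<in> level (Suc i). coroot_pair g a = 1}. (v g)\<^sup>2)"
      unfolding FF_def
    proof (rule sum.reindex_bij_witness[of _ "\<lambda>g. g - a" "\<lambda>d. d + a"])
    qed (use level_up level_down a pair_simple in
        \<open>auto simp: Fset_def coroot_pair_add coroot_pair_diff power2_eq_square\<close>)
    moreover have "EE a a = (\<Sum>g\<in>{g \<in> level (Suc i). coroot_pair g a = -1}. (v g)\<^sup>2)"
      unfolding EE_def
    proof (rule sum.reindex_bij_witness[of _ "\<lambda>g. g + a" "\<lambda>e. e - a"])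
    qed (use level_up level_down a pair_simple in
        \<open>auto simp: Eset_def coroot_pair_add coroot_pair_diff power2_eq_square\<close>)
    ultimately have "FF a a - EE a a = (\<Sum>g\<in>level (Suc i).
        (if coroot_pair g a = 1 then (v g)\<^sup>2 else 0) - (if coroot_pair g a = -1 then (v g)\<^sup>2 else 0))"
      by (simp only: sum.inter_filter[OF finite_level] sum_subtractf)
    also have "\<dots> = (\<Sum>g\<in>level (Suc i). coroot_pair g a * (v g)\<^sup>2)"
    proof (rule sum.cong[OF HOL.refl])
      fix g assume g: "g \<in> level (Suc i)"
      then have "g \<in> Sp" "g \<noteq> a" using level_not_simple[OF g _ a] i by (auto simp: level_def)
      then have "coroot_pair g a \<in> {-1, 0, 1}" using short_pair_simple a by blast
      then show "(if coroot_pair g a = 1 then (v g)\<^sup>2 else 0) - (if coroot_pair g a = -1 then (v g)\<^sup>2 else 0)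
          = coroot_pair g a * (v g)\<^sup>2" by auto
    qed
    finally show ?thesis .
  qed
  have "(\<Sum>a\<in>P. \<Sum>b\<in>P. s a * s b * FF a b) - (\<Sum>a\<in>P. \<Sum>b\<in>P. s a * s b * EE a b)
      = (\<Sum>a\<in>P. \<Sum>b\<in>P. if b = a then c a * (FF a a - EE a a) else 0)"
    unfolding sum_subtractf[symmetric]
  proof (intro sum.cong[OF HOL.refl])
    fix a b assume "a \<in> P" "b \<in> P"
    then show "s a * s b * FF a b - s a * s b * EE a b = (if b = a then c a * (FF a a - EE a a) else 0)"
      using off[of a b] c0[of a] by (auto simp: s_def right_diff_distrib)
  qed
  also have "\<dots> = (\<Sum>a\<in>P. c a * (FF a a - EE a a))"
    using finite_P by (intro sum.cong) auto
  also have "\<dots> = (\<Sum>a\<in>P. \<Sum>g\<in>level (Suc i). c a * coroot_pair g a * (v g)\<^sup>2)"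
    using diag by (intro sum.cong) (auto simp: sum_distrib_left mult.assoc)
  also have "\<dots> = (\<Sum>g\<in>level (Suc i). hgt g * (v g)\<^sup>2)"
    by (subst sum.swap) (simp add: c sum_distrib_right)
  also have "\<dots> = (\<Sum>g\<in>level (Suc i). real (Suc i) * (v g)\<^sup>2)"
    by (rule sum.cong) (auto simp: level_def)
  also have "\<dots> > 0"
  proof -
    obtain g where g: "g \<in> level (Suc i)" "v g \<noteq> 0" using v by blast
    show ?thesis by (rule sum_pos2[OF finite_level g(1)]) (use g(2) in auto)
  qed
  finally show False using F0 E0 by linarith
qed

end

section \<open>The dominant short root\<close>

lemma span_orthogonal:
  assumes "\<And>s t. s \<in> S \<Longrightarrow> t \<in> T \<Longrightarrow> s \<bullet> t = 0" "x \<in> span S" "y \<in> span T"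
  shows "x \<bullet> y = 0"
proof -
  have "orthogonal y s" if "s \<in> S" for s
  proof -
    have "orthogonal s y"
      by (rule orthogonal_to_span[OF assms(3)]) (use assms(1) that in \<open>simp add: orthogonal_def\<close>)
    then show ?thesis by (simp add: orthogonal_commute)
  qed
  then have "orthogonal y x" by (rule orthogonal_to_span[OF assms(2)])
  then show ?thesis by (simp add: orthogonal_def inner_commute)
qed

locale irreducible_based_root_system = based_root_system +
  assumes irreducible: "irreducible_rs R"
begin

text \<open>If \<open>S\<close> were proper, simple reflections would preserve
  \<open>span S \<union> span T\<close> with \<open>T\<close> the complement. Every root is up to
  sign conjugate to a simple one, so \<open>R\<close> would split into orthogonal parts.\<close>

lemma base_connected:
  assumes S: "S \<subseteq> P" "S \<noteq> {}" and orth: "\<And>a b. a \<in> S \<Longrightarrow> b \<in> P - S \<Longrightarrow> a \<bullet> b = 0"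
  shows "S = P"
proof (rule ccontr)
  assume "S \<noteq> P"
  define T where "T = P - S"
  have T: "T \<noteq> {}" "T \<subseteq> P" "P = S \<union> T" using S \<open>S \<noteq> P\<close> by (auto simp: T_def)
  have ortho: "x \<bullet> y = 0" if "x \<in> span S" "y \<in> span T" for x y
    using span_orthogonal[OF _ that] orth by (auto simp: T_def)
  have step: "refl a x \<in> span S \<union> span T" if a: "a \<in> P" and x: "x \<in> span S \<union> span T" for a x
  proof -
    have *: "refl a x \<in> span A" if "a \<in> span A" "x \<in> span A" for A
      using that by (simp add: refl_def span_diff span_scale)
    have **: "refl a x = x" if "x \<bullet> a = 0"
      using that by (simp add: refl_def coroot_pair_def)
    have "a \<in> span S \<or> a \<in> span T" using a T(3) span_base by blast
    then show ?thesis
      using * ** x ortho[of x a] ortho[of a x] by (auto simp: inner_commute)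
  qed
  have word: "refl_word as x \<in> span S \<union> span T"
    if "set as \<subseteq> P" "x \<in> span S \<union> span T" for as x
    using that by (induction as) (use step in auto)
  have pos: "b \<in> span S \<union> span T" if b: "b \<in> \<Delta>p" for b
  proof -
    obtain as a where "set as \<subseteq> P" "a \<in> P" "b = refl_word as a"
      using pos_root_conj_simple[OF b] by blast
    moreover have "a \<in> span S \<union> span T" using \<open>a \<in> P\<close> T(3) span_base by blast
    ultimately show ?thesis using word by blast
  qed
  have all: "b \<in> span S \<union> span T" if b: "b \<in> R" for b
  proof (cases "b \<in> \<Delta>p")
    case False
    then have "- b \<in> span S \<union> span T" using pos pos_or_neg b by blast
    then show ?thesis using span_neg[of "- b"] by fastforce
  qed (rule pos)
  have "R \<inter> span S \<noteq> {}" "R \<inter> span T \<noteq> {}"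
    using S T P_in_R span_base by blast+
  moreover have "(R \<inter> span S) \<union> (R \<inter> span T) = R" using all by blast
  moreover have "(R \<inter> span S) \<inter> (R \<inter> span T) = {}"
    using ortho nonzero_root by (metis (no_types, lifting) IntE disjoint_iff inner_eq_zero_iff)
  moreover have "\<forall>a\<in>R \<inter> span S. \<forall>b\<in>R \<inter> span T. a \<bullet> b = 0" using ortho by blast
  ultimately show False using irreducible unfolding irreducible_rs_def by metis
qed

text \<open>For \<open>b\<close> outside the support, \<open>t \<bullet> b\<close> is nonnegative
  but expands into nonpositive terms, so all of them vanish. The support is then orthogonal to its
  complement in \<open>P\<close>, and \<open>base_connected\<close> applies.\<close>

lemma dominant_root_full_support:
  assumes t: "t \<in> R" "\<And>a. a \<in> P \<Longrightarrow> t \<bullet> a \<ge> 0" and a: "a \<in> P"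
  shows "cf t a > 0"
proof -
  have pos: "t \<in> \<Delta>p" using dominant_root_pos t by blast
  define S where "S = {a \<in> P. cf t a > 0}"
  have nS: "cf t b = 0" if "b \<in> P - S" for b
    using that cf_nonneg[OF pos, of b] by (auto simp: S_def)
  have "S = P"
  proof (rule base_connected)
    show "S \<subseteq> P" by (auto simp: S_def)
    show "S \<noteq> {}"
    proof
      assume "S = {}"
      then have "t = 0" using nS by (intro cf_eqI) (simp add: cf_zero)
      then show False using t zero_notin_R by blast
    qed
    fix c b assume c: "c \<in> S" and b: "b \<in> P - S"
    have le: "cf t d * (d \<bullet> b) \<le> 0" if "d \<in> P" for d
    proof (cases "d = b")
      case True
      then show ?thesis using nS[OF b] by simp
    next
      case False
      then show ?thesis
        using simple_inner_nonpos[of d b] cf_nonneg[OF pos that] that b by (simp add: mult_nonneg_nonpos)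
    qed
    have "t \<bullet> b = (\<Sum>d\<in>P. cf t d * (d \<bullet> b))"
      by (subst cf_expand[of t]) (simp add: inner_sum_left)
    moreover have "t \<bullet> b \<ge> 0" using t b by blast
    moreover have "(\<Sum>d\<in>P. cf t d * (d \<bullet> b)) \<le> 0" using le by (rule sum_nonpos)
    ultimately have "(\<Sum>d\<in>P. cf t d * (d \<bullet> b)) = 0" by linarith
    then have "\<forall>d\<in>P. cf t d * (d \<bullet> b) = 0"
      using sum_nonneg_eq_0_iff[OF finite_P, of "\<lambda>d. - (cf t d * (d \<bullet> b))"] le
      by (simp add: sum_negf)
    then show "c \<bullet> b = 0" using c by (auto simp: S_def)
  qed
  then show ?thesis using a by (auto simp: S_def)
qed

text \<open>Full support gives \<open>t \<bullet> u > 0\<close>. For distinct short roots the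
  pairing is then 1, so \<open>t - u\<close> is a root, which equality of lengths excludes.\<close>

lemma dominant_short_unique:
  assumes t: "t \<in> Sh" "\<And>a. a \<in> P \<Longrightarrow> t \<bullet> a \<ge> 0" and u: "u \<in> Sh" "\<And>a. a \<in> P \<Longrightarrow> u \<bullet> a \<ge> 0"
  shows "t = u"
proof (rule ccontr)
  assume "t \<noteq> u"
  have R: "t \<in> R" "u \<in> R" using t u short_R by blast+
  have tp: "t \<in> \<Delta>p" and up: "u \<in> \<Delta>p" using dominant_root_pos R t u by blast+
  have norm: "t \<bullet> t = u \<bullet> u" using t u by (auto simp: short_roots_def intro: antisym)
  obtain a where a: "a \<in> P" "u \<bullet> a > 0" using exists_simple_inner_pos[OF up] by blast
  have "u \<bullet> t = (\<Sum>d\<in>P. cf t d * (u \<bullet> d))"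
    by (subst cf_expand[of t]) (simp add: inner_sum_right)
  also have "\<dots> > 0"
  proof (rule sum_pos2[OF finite_P a(1)])
    show "0 < cf t a * (u \<bullet> a)" using a dominant_root_full_support[OF R(1) t(2) a(1)] by simp
    show "0 \<le> cf t d * (u \<bullet> d)" if "d \<in> P" for d
      using that u(2) cf_nonneg[OF tp] by simp
  qed
  finally have "coroot_pair t u > 0" using coroot_pair_pos_iff[OF R(2)] by (simp add: inner_commute)
  then have "coroot_pair t u = 1"
    using short_pair[OF t(1) R(2) \<open>t \<noteq> u\<close>] pos_neq_neg[OF tp up] by auto
  then have d: "t - u \<in> R" using refl_in_R[OF R(2,1)] by (simp add: refl_def)
  \<comment> \<open>If \<open>x - y\<close> is positive and \<open>y\<close> dominant, then
    \<open>x\<close> is strictly longer than \<open>y\<close>. This serves for \<open>t - u\<close>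
    or \<open>u - t\<close>, whichever is positive.\<close>
  have False if x: "x - y \<in> \<Delta>p" "\<And>a. a \<in> P \<Longrightarrow> y \<bullet> a \<ge> 0" "x \<bullet> x = y \<bullet> y" for x y
  proof -
    have "y \<bullet> (x - y) \<ge> 0" using inner_cone_nonneg x cf_nonneg by blast
    moreover have "x \<bullet> x = y \<bullet> y + 2 * (y \<bullet> (x - y)) + (x - y) \<bullet> (x - y)"
      by (simp add: inner_diff_left inner_diff_right inner_commute)
    moreover have "(x - y) \<bullet> (x - y) > 0"
      using nonzero_root[OF pos_root_R[OF x(1)]] inner_gt_zero_iff by blast
    ultimately show False using x(3) by linarith
  qed
  then show False
    using pos_or_neg[OF d] norm t(2) u(2) by (metis minus_diff_eq)
qed

text \<open>A short root of maximal height works, since reflecting in a simple root of negative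
  pairing would raise the height.\<close>

lemma dominant_short_exists: "\<exists>t\<in>Sh. \<forall>a\<in>P. t \<bullet> a \<ge> 0"
proof -
  have "R \<noteq> {}" using irreducible by (simp add: irreducible_rs_def)
  then obtain g where "is_arg_min (\<lambda>x. x \<bullet> x) (\<lambda>x. x \<in> R) g"
    using ex_is_arg_min_if_finite[OF finite_R] by blast
  then have "g \<in> Sh" by (auto simp: short_roots_def is_arg_min_linorder)
  then have fin: "finite (hgt ` Sh)" "hgt ` Sh \<noteq> {}" using finite_Sh by auto
  then obtain t where t: "t \<in> Sh" "hgt t = Max (hgt ` Sh)"
    using Max_in[OF fin] by (metis imageE)
  have "t \<bullet> a \<ge> 0" if a: "a \<in> P" for a
  proof (rule ccontr)
    assume "\<not> ?thesis"
    then have "coroot_pair t a < 0" using coroot_pair_neg_iff[OF P_in_R[OF a]] by simp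
    then have "hgt (refl a t) > Max (hgt ` Sh)" using hgt_refl[OF a] t by simp
    moreover have "refl a t \<in> Sh" using short_refl t P_in_R a by blast
    ultimately show False using Max_ge[OF fin(1)] by (metis imageI not_less)
  qed
  then show ?thesis using t by blast
qed

section \<open>Walking along the short roots\<close>

abbreviation \<theta> :: 'a where "\<theta> \<equiv> theta_s R P"

lemma theta_short_dominant: "\<theta> \<in> Sh \<and> \<theta> \<in> dominant R P"
  unfolding theta_s_def
proof (rule theI')
  show "\<exists>!t. t \<in> Sh \<and> t \<in> dominant R P"
    using dominant_short_exists dominant_short_unique dominant_root_iff short_R by metis
qed

lemma theta_short: "\<theta> \<in> Sh"
  and theta_inner: "a \<in> P \<Longrightarrow> \<theta> \<bullet> a \<ge> 0"
  and theta_Sp: "\<theta> \<in> Sp"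
  using theta_short_dominant dominant_root_iff[of \<theta>] dominant_root_pos[of \<theta>] short_R by auto

lemma short_not_theta: "g \<in> Sh \<Longrightarrow> g \<noteq> \<theta> \<Longrightarrow> \<exists>a\<in>P. g \<bullet> a < 0"
  using dominant_short_unique[of g \<theta>] theta_short theta_inner by (meson not_less)

text \<open>A short positive root other than \<open>\<theta>\<close> pairs to -1 with some simple
  \<open>a\<close>. Then \<open>g + a\<close> pairs to 1 with \<open>a\<close>, and
  \<open>lm_pair_1\<close> costs one factor q per step up. The induction runs on the gap to the
  largest height.\<close>

lemma lm_theta_pos:
  "g \<in> Sp \<Longrightarrow> \<exists>n. lm \<theta> g = monom 1 n \<and> hgt \<theta> - hgt g = real n"
proof (induction "nat \<lfloor>Max (hgt ` Sp) - hgt g\<rfloor>" arbitrary: g rule: less_induct)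
  case less
  show ?case
  proof (cases "g = \<theta>")
    case True
    then show ?thesis using lm_self[of \<theta>] theta_inner by (intro exI[of _ 0]) simp
  next
    case False
    then obtain a where a: "a \<in> P" "g \<bullet> a < 0" using short_not_theta less.prems by blast
    have "g \<noteq> a" using a inner_ge_zero[of a] by (auto simp del: inner_ge_zero)
    moreover have "coroot_pair g a < 0" using a coroot_pair_neg_iff[OF P_in_R] by blast
    ultimately have ga: "coroot_pair g a = -1" using short_pair_simple[OF less.prems a(1)] by auto
    note up = short_up[OF less.prems a(1) ga]
    have "hgt (g + a) \<le> Max (hgt ` Sp)" using up(1) finite_Sp by (intro Max_ge) auto
    then have "nat \<lfloor>Max (hgt ` Sp) - hgt (g + a)\<rfloor> < nat \<lfloor>Max (hgt ` Sp) - hgt g\<rfloor>"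
      using up(2) by linarith
    then obtain n where n: "lm \<theta> (g + a) = monom 1 n" "hgt \<theta> - hgt (g + a) = real n"
      using less.hyps up(1) by blast
    have "coroot_pair (g + a) a = 1"
      using ga coroot_pair_self[OF nonzero_root[OF P_in_R[OF a(1)]]] by (simp add: coroot_pair_add)
    then have "lm \<theta> g = monom 1 1 * monom 1 n"
      using lm_pair_1[OF a(1), of "g + a" \<theta>] n(1) by simp
    then have "lm \<theta> g = monom 1 (Suc n)" by (simp add: mult_monom)
    moreover have "hgt \<theta> - hgt g = real (Suc n)" using n(2) up(2) by simp
    ultimately show ?thesis by blast
  qed
qed

text \<open>Descend from \<open>g\<close> to a simple root through roots with
  \<open>coroot_pair g a = 1\<close>. Then \<open>- (g - a)\<close> pairs to 1 with
  \<open>a\<close>, so each step gives one factor q. The weight \<open>lam\<close> is free because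
  both \<open>\<theta>\<close> and 0 are needed.\<close>

lemma lm_neg_short:
  "g \<in> Sp \<Longrightarrow> \<exists>a\<in>P \<inter> Sh. \<exists>n. lm lam (- g) = monom 1 n * lm lam (- a) \<and> hgt g = real n + 1"
proof (induction "nat \<lfloor>hgt g\<rfloor>" arbitrary: g rule: less_induct)
  case less
  show ?case
  proof (cases "g \<in> P")
    case True
    then show ?thesis using less.prems hgt_base
      by (intro bexI[of _ g] exI[of _ 0]) (auto simp: monom_0 one_pCons[symmetric])
  next
    case False
    then obtain a where a: "a \<in> P" "coroot_pair g a = 1"
      using short_not_simple_down less.prems by blast
    note down = short_down[OF less.prems a]
    have "nat \<lfloor>hgt (g - a)\<rfloor> < nat \<lfloor>hgt g\<rfloor>"
      using down hgt_pos[of "g - a"] by auto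
    then obtain b n where n: "b \<in> P \<inter> Sh" "lm lam (- (g - a)) = monom 1 n * lm lam (- b)"
        "hgt (g - a) = real n + 1"
      using less.hyps[OF _ down(1)] by blast
    have "coroot_pair (- (g - a)) a = 1"
      using a coroot_pair_self[OF nonzero_root[OF P_in_R[OF a(1)]]]
      by (simp only: coroot_pair_minus coroot_pair_diff)
    then have "lm lam (- (g - a) - a) = monom 1 1 * (monom 1 n * lm lam (- b))"
      using lm_pair_1[OF a(1), of "- (g - a)" lam] n(2) by (simp only:)
    then have "lm lam (- g) = monom 1 (Suc n) * lm lam (- b)"
      by (simp add: mult_monom flip: mult.assoc)
    moreover have "hgt g = real (Suc n) + 1" using n(3) down(2) by simp
    ultimately show ?thesis using n(1) by blast
  qed
qed

lemma lm_theta_neg_simple: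
  assumes a: "a \<in> P \<inter> Sh"
  shows "lm \<theta> (- a) = [:-1, 1:] * lm \<theta> 0 + monom 1 (nat (ht P \<theta>))"
proof -
  have aSp: "a \<in> Sp" using a P_pos by blast
  obtain n where n: "lm \<theta> a = monom 1 n" "hgt \<theta> - hgt a = real n"
    using lm_theta_pos[OF aSp] by blast
  then have "real_of_int (ht P \<theta>) = real n + 1"
    using hgt_base a ht_root[OF short_R[OF theta_short]] by simp
  then have "nat (ht P \<theta>) = Suc n" by linarith
  then show ?thesis using lm_neg_simple[of a \<theta>] a n(1) by (simp only: mult_monom) simp
qed

section \<open>The value at weight zero\<close>

lemma lm_0_0: "lm 0 0 = 1"
  using lm_self[of 0] by simp

text \<open>At highest weight 0 the values at 0 and at a simple root are 1 and 0, so
  \<open>lm_neg_simple\<close> gives q - 1 at the end of the descent.\<close>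

lemma lm_0_neg_short: "g \<in> Sp \<Longrightarrow> lm 0 (- g) = monom 1 (nat (ht P g) - 1) * [:-1, 1:]"
proof -
  assume g: "g \<in> Sp"
  obtain a n where an: "a \<in> P \<inter> Sh" "lm 0 (- g) = monom 1 n * lm 0 (- a)" "hgt g = real n + 1"
    using lm_neg_short[OF g] by blast
  have "lm 0 (- a) = [:-1, 1:] * 1 + monom 1 1 * 0"
    using lm_neg_simple[of a 0] lm_0_0 lm_0_pos[OF P_pos, of a] an by simp
  moreover have "real_of_int (ht P g) = real n + 1"
    using an(3) g ht_root short_R by simp
  then have "nat (ht P g) - 1 = n" by linarith
  ultimately show ?thesis using an(2) by simp
qed

text \<open>If \<open>- g\<close> is simple, its reflection carries \<open>g + rho R P\<close> to
  \<open>rho R P\<close>, with sign -1. Any other \<open>g\<close> except \<open>\<theta>\<close>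
  pairs to -1 with some simple root, and then \<open>g + rho R P\<close> lies on its wall.\<close>

lemma alt_q_short:
  assumes g: "g \<in> Sh"
  shows "alt_q (g + rho R P) y = (if g = \<theta> then alt_q (\<theta> + rho R P) y else 0)
      - (if - g \<in> P then alt_q (rho R P) y else 0)"
proof (cases "g = \<theta>")
  case True
  then have "- g \<notin> P" using theta_Sp P_pos pos_not_neg by blast
  then show ?thesis using True by simp
next
  case False
  show ?thesis
  proof (cases "- g \<in> P")
    case True
    have "refl (- g) g = - g"
      using refl_self[OF nonzero_root[OF short_R[OF g]]] by (simp add: refl_uminus)
    then have "refl (- g) (g + rho R P) = rho R P"
      using refl_rho[OF True] by (simp add: refl_add)
    then have "alt_q (rho R P) y = - alt_q (g + rho R P) y"
      using alt_q_refl[OF True, of "g + rho R P" y] by simp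
    then show ?thesis using True False by simp
  next
    case nP: False
    obtain a where a: "a \<in> P" "g \<bullet> a < 0" using short_not_theta g False by blast
    have "g \<noteq> a" using a inner_ge_zero[of a] by (auto simp del: inner_ge_zero)
    moreover have "g \<noteq> - a" using nP a by auto
    moreover have "coroot_pair g a < 0" using a coroot_pair_neg_iff[OF P_in_R] by blast
    ultimately have "coroot_pair g a = -1" using short_pair[OF g P_in_R[OF a(1)]] by auto
    then have "coroot_pair (g + rho R P) a = 0" using coroot_pair_rho a by (simp add: coroot_pair_add)
    then show ?thesis using alt_q_singular[OF a(1)] False nP by simp
  qed
qed

text \<open>Among the short roots \<open>g\<close>, only \<open>\<theta>\<^sub>s\<close> and the negatives of simple roots make \<open>g + \<rho>\<close>
  regular; the latter contribute \<open>-l\<close> times the alternating sum at \<open>\<rho>\<close>.\<close>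

lemma lm_theta_eq_sum:
  "lm \<theta> mu = of_nat (card (P \<inter> Sh)) * lm 0 mu + (\<Sum>g\<in>Sh. lm 0 (mu - g))"
proof -
  let ?\<rho> = "rho R P"
  have "(\<Sum>g\<in>Sh. lm 0 (mu - g)) = (\<Sum>g\<in>Sh. alt_q (g + ?\<rho>) (mu + ?\<rho>))"
  proof -
    have "(\<Sum>g\<in>Sh. lm 0 (mu - g))
        = (\<Sum>w\<in>weyl R. \<Sum>g\<in>Sh. sg w * partition_q \<Delta>p (w ?\<rho> - (mu - g + ?\<rho>)))"
      unfolding lusztig_m_eq alt_q_def by (subst sum.swap) simp
    also have "\<dots> = (\<Sum>w\<in>weyl R. \<Sum>g\<in>Sh. sg w * partition_q \<Delta>p (w (g + ?\<rho>) - (mu + ?\<rho>)))"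
    proof (rule sum.cong[OF HOL.refl])
      fix w assume "w \<in> weyl R"
      then obtain as where as: "set as \<subseteq> P" "w = refl_word as" using weyl_cases by blast
      \<comment> \<open>The set of short roots is stable under the Weyl group, so \<open>g\<close>
        may be replaced by \<open>w g\<close> inside the sum for each \<open>w\<close>.\<close>
      have bij: "bij_betw w Sh Sh"
        unfolding as(2)
        by (rule bij_betw_byWitness[of _ "refl_word (rev as)"])
          (use as(1) short_refl_word[of as] short_refl_word[of "rev as"] in auto)
      have eq: "w ?\<rho> - (mu - w g + ?\<rho>) = w (g + ?\<rho>) - (mu + ?\<rho>)" for g
        unfolding as(2) linear_add[OF linear_refl_word] by simp
      show "(\<Sum>g\<in>Sh. sg w * partition_q \<Delta>p (w ?\<rho> - (mu - g + ?\<rho>)))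
          = (\<Sum>g\<in>Sh. sg w * partition_q \<Delta>p (w (g + ?\<rho>) - (mu + ?\<rho>)))"
        using sum.reindex_bij_betw[OF bij, of "\<lambda>g. sg w * partition_q \<Delta>p (w ?\<rho> - (mu - g + ?\<rho>))"]
        unfolding eq by (rule sym)
    qed
    also have "\<dots> = (\<Sum>g\<in>Sh. alt_q (g + ?\<rho>) (mu + ?\<rho>))"
      unfolding alt_q_def by (rule sum.swap)
    finally show ?thesis .
  qed
  also have "\<dots> = (\<Sum>g\<in>Sh. (if g = \<theta> then alt_q (\<theta> + ?\<rho>) (mu + ?\<rho>) else 0))
      - (\<Sum>g\<in>Sh. (if - g \<in> P then alt_q ?\<rho> (mu + ?\<rho>) else 0))"
    unfolding sum_subtractf[symmetric] by (rule sum.cong[OF HOL.refl], rule alt_q_short)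
  also have "(\<Sum>g\<in>Sh. (if g = \<theta> then alt_q (\<theta> + ?\<rho>) (mu + ?\<rho>) else 0)) = lm \<theta> mu"
    using finite_Sh theta_short by (simp add: lusztig_m_eq)
  also have "(\<Sum>g\<in>Sh. (if - g \<in> P then alt_q ?\<rho> (mu + ?\<rho>) else 0)) = of_nat (card (P \<inter> Sh)) * lm 0 mu"
  proof -
    have "bij_betw uminus (P \<inter> Sh) {g \<in> Sh. - g \<in> P}"
      by (rule bij_betw_byWitness[of _ uminus]) (use short_minus in \<open>auto intro: rev_image_eqI\<close>)
    then have "card {g \<in> Sh. - g \<in> P} = card (P \<inter> Sh)" using bij_betw_same_card by metis
    moreover have "(\<Sum>g\<in>Sh. (if - g \<in> P then alt_q ?\<rho> (mu + ?\<rho>) else 0))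
        = of_nat (card {g \<in> Sh. - g \<in> P}) * alt_q ?\<rho> (mu + ?\<rho>)"
      by (subst sum.inter_filter[OF finite_Sh, symmetric]) simp
    ultimately show ?thesis by (simp add: lusztig_m_eq)
  qed
  finally show ?thesis by simp
qed

lemma sum_Sh_lm_0: "(\<Sum>g\<in>Sh. lm 0 (0 - g)) = (\<Sum>g\<in>Sp. lm 0 (- g))"
proof -
  have "lm 0 (0 - g) = 0" if "g \<in> Sh - Sp" for g
    using that pos_or_neg[OF short_R] lm_0_pos by auto
  then have "(\<Sum>g\<in>Sp. lm 0 (0 - g)) = (\<Sum>g\<in>Sh. lm 0 (0 - g))"
    by (intro sum.mono_neutral_left) (auto simp: finite_Sh)
  then show ?thesis by simp
qed

lemma n_s_eq_level: "n_s R P i = card (level i)"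
proof -
  have "{g \<in> \<Delta>p \<inter> Sh. ht P g = int i} = level i"
    unfolding level_def using ht_root[OF short_R] by force
  then show ?thesis by (simp add: n_s_def)
qed

lemma level_1: "level 1 = P \<inter> Sh"
  using hgt_one_simple hgt_base P_pos by (auto simp: level_def)

lemma lm_theta_0: "lm \<theta> 0 = (\<Sum>j=1..card (P \<inter> Sh). monom 1 (e_s R P j))"
proof -
  let ?h = "\<lambda>g. nat (ht P g)"
  have h: "real (?h g) = hgt g" if "g \<in> Sp" for g
    using ht_root[OF short_R, of g] hgt_pos[of g] that by auto
  have lev: "level i = {g \<in> Sp. ?h g = i}" for i
    unfolding level_def using h by (metis (no_types, lifting) of_nat_eq_iff)
  have "(\<Sum>j=1..n_s R P 1. monom 1 (card {i. 1 \<le> i \<and> j \<le> n_s R P i}) :: int poly)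
       = of_nat (n_s R P 1) + (\<Sum>g\<in>Sp. monom 1 (?h g - 1) * [:-1, 1:])"
  proof (rule sum_conjugate_partition[OF finite_Sp])
    show "1 \<le> ?h g" if "g \<in> Sp" for g
    proof -
      have "real (?h g) \<ge> 1" using h[OF that] hgt_pos that by simp
      then show ?thesis by linarith
    qed
    show "n_s R P i = card {g \<in> Sp. ?h g = i}" for i
      by (simp only: n_s_eq_level lev)
    show "n_s R P (Suc i) \<le> n_s R P i" if "i \<ge> 1" for i
      using card_level_mono[OF that] by (simp only: n_s_eq_level)
  qed
  moreover have "n_s R P 1 = card (P \<inter> Sh)" by (simp only: n_s_eq_level level_1)
  moreover have "(\<Sum>g\<in>Sp. monom 1 (?h g - 1) * [:-1, 1:]) = (\<Sum>g\<in>Sp. lm 0 (- g))"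
    by (rule sum.cong) (simp_all only: lm_0_neg_short)
  ultimately show ?thesis
    using lm_theta_eq_sum[of 0] sum_Sh_lm_0 by (simp add: lm_0_0 e_s_def)
qed

section \<open>The final formulas in terms of \<open>ht\<close>\<close>

lemma lm_theta_pos_ht:
  assumes "g \<in> Sp"
  shows "lm \<theta> g = monom 1 (nat (ht P (\<theta> - g)))"
proof -
  obtain n where n: "lm \<theta> g = monom 1 n" "hgt \<theta> - hgt g = real n"
    using lm_theta_pos[OF assms] by blast
  have "real_of_int (ht P (\<theta> - g)) = hgt (\<theta> - g)"
    by (rule ht_eq) (use assms theta_short short_R cf_Ints in \<open>auto simp: cf_diff\<close>)
  then have "nat (ht P (\<theta> - g)) = n" using n(2) by (simp add: hgt_diff)
  then show ?thesis using n(1) by simp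
qed

text \<open>The descent ends at some short simple \<open>b\<close> that cannot be prescribed. By
  \<open>lm_theta_neg_simple\<close> the value at \<open>- b\<close> equals that at
  \<open>- a\<close>.\<close>

lemma lm_theta_neg_ht:
  assumes g: "g \<in> Sp" and a: "a \<in> P \<inter> Sh"
  shows "lm \<theta> (- g) = monom 1 (nat (ht P g - 1)) * lm \<theta> (- a)"
proof -
  obtain b n where bn: "b \<in> P \<inter> Sh" "lm \<theta> (- g) = monom 1 n * lm \<theta> (- b)" "hgt g = real n + 1"
    using lm_neg_short[OF g] by blast
  have "real_of_int (ht P g) = real n + 1" using bn(3) ht_root[OF short_R, of g] g by simp
  then have "nat (ht P g - 1) = n" by linarith
  then show ?thesis using bn(2) lm_theta_neg_simple[OF a] lm_theta_neg_simple[OF bn(1)] by simp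
qed

text \<open>The sign of the height separates positive short roots, 0 and negative short roots, so
  two weights of equal height fall under the same formula.\<close>

lemma lm_theta_depends_on_ht:
  assumes mu: "mu \<in> Sh \<union> {0}" and nu: "nu \<in> Sh \<union> {0}" and ht: "ht P mu = ht P nu"
  shows "lm \<theta> mu = lm \<theta> nu"
proof -
  have hgt: "real_of_int (ht P x) = hgt x" if "x \<in> Sh \<union> {0}" for x
    using that ht_root short_R ht_eq[of 0] by (auto simp: cf_zero)
  have cases: "x \<in> Sp \<and> hgt x > 0 \<or> x = 0 \<and> hgt x = 0 \<or> - x \<in> Sp \<and> hgt x < 0"
    if "x \<in> Sh \<union> {0}" for x
  proof (cases "x = 0")
    case False
    then have x: "x \<in> Sh" using that by simp
    then show ?thesis
      using pos_or_neg[OF short_R[OF x]] short_minus[OF x] hgt_pos[of x] hgt_pos[of "- x"]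
      by (auto simp: hgt_minus)
  qed (simp add: hgt_zero)
  have eq: "hgt mu = hgt nu" using hgt mu nu ht by metis
  consider "mu \<in> Sp" "nu \<in> Sp" | "mu = 0" "nu = 0" | "- mu \<in> Sp" "- nu \<in> Sp"
    using cases[OF mu] cases[OF nu] eq by auto
  then show ?thesis
  proof cases
    case 1
    obtain m n where "lm \<theta> mu = monom 1 m" "hgt \<theta> - hgt mu = real m"
      "lm \<theta> nu = monom 1 n" "hgt \<theta> - hgt nu = real n"
      using lm_theta_pos 1 by meson
    then show ?thesis using eq by simp
  next
    case 2
    then show ?thesis by simp
  next
    case 3
    obtain a where a: "a \<in> P \<inter> Sh" using lm_neg_short[OF 3(1)] by blast
    have "real_of_int (ht P (- mu)) = real_of_int (ht P (- nu))"
      using 3 eq ht_root[OF short_R] by (simp add: hgt_minus)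
    then show ?thesis
      using lm_theta_neg_ht[OF 3(1) a] lm_theta_neg_ht[OF 3(2) a] by simp
  qed
qed

end

theorem theorem2p4:
  fixes R P :: "'a::euclidean_space set"
  assumes "root_system R" and "irreducible_rs R" and "is_base R P"
  defines "\<theta> \<equiv> theta_s R P"
    and "l \<equiv> card (P \<inter> short_roots R)"
    and "m \<equiv> lusztig_m R P (theta_s R P)"
  shows "(\<forall>mu\<in>short_roots R \<union> {0}. \<forall>nu\<in>short_roots R \<union> {0}.
            ht P mu = ht P nu \<longrightarrow> m mu = m nu)
     \<and> m 0 = (\<Sum>j=1..l. monom 1 (e_s R P j))
     \<and> (\<forall>mu\<in>short_roots R \<inter> pos_roots R P.
            m mu = monom 1 (nat (ht P (\<theta> - mu))))
     \<and> (\<forall>a\<in>P \<inter> short_roots R.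
            m (- a) = [:-1, 1:] * m 0 + monom 1 (nat (ht P \<theta>)))
     \<and> (\<forall>g\<in>short_roots R \<inter> pos_roots R P. \<forall>a\<in>P \<inter> short_roots R.
            m (- g) = monom 1 (nat (ht P g - 1)) * m (- a))"
proof -
  interpret irreducible_based_root_system R P
    using assms by unfold_locales
  show ?thesis
    unfolding m_def \<theta>_def l_def
    using lm_theta_depends_on_ht lm_theta_0 lm_theta_pos_ht lm_theta_neg_simple lm_theta_neg_ht
    by blast
qed

end
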